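(* Let $k$ be an algebraically closed field of characteristic $p>0$ and let $B:=\mathcal{O}(\mathbb{Z}/p\mathbb{Z})$ be the Hopf algebra of functions on $\mathbb{Z}/p\mathbb{Z}$ with values in $k$. Then the Sweedler cohomology of $B$ is as follows: $H^1_{\mathrm{Sw}}(B)=\mathbb{Z}/p\mathbb{Z}$, and $H^i_{\mathrm{Sw}}(B)=0$ for every $i\ge2$.
   Context: For a finite dimensional cocommutative Hopf algebra $B$ over $k$, $H^n_{\mathrm{Sw}}(B):=H^n_{\mathrm{Sw}}(B,k)$ is the Sweedler cohomology of $B$ with coefficients in the trivial $B$-module algebra $k$: $n$-cochains are convolution-invertible linear maps $B^{\otimes n}\to k$, i.e. invertible elements of the commutative algebra $(B^* )^{\otimes n}$, with the multiplicative bar differential (alternating product of the cofaces given by $1\otimes-$, by applying $\Delta_{B^*}$ in each slot, and by $-\otimes1$). *)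

theory Defs
  imports "HOL-Algebra.Algebra" "HOL-Algebra.Algebraic_Closure_Type"
begin

text \<open>
  The ground field is a type \<open>'k\<close>. The comultiplication of a Hopf algebra is given in Sweedler
  notation: \<open>comult B b\<close> is a finite set of pairs with \<open>\<Delta>(b) = \<Sum>(x, y) \<in> comult B b. x \<otimes> y\<close>.
  This is no restriction, since every tensor is a sum of pairwise distinct elementary tensors.
  Linear maps \<open>B\<^sup>\<otimes>\<^sup>n \<rightarrow> k\<close> are represented by the corresponding multilinear maps on \<open>n\<close>-tuples, so
  that expressions \<open>\<Sum>(x, y) \<in> comult B b. T [x, y]\<close> depend only on the tensor \<open>\<Delta>(b)\<close>.
\<close>

record ('k, 'b) hopf_algebra = "('k, 'b) module" +
  comult :: "'b \<Rightarrow> ('b \<times> 'b) set"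
  counit :: "'b \<Rightarrow> 'k"
  antipode :: "'b \<Rightarrow> 'b"

definition tuples :: "('k::field, 'b) hopf_algebra \<Rightarrow> nat \<Rightarrow> 'b list set" where
  "tuples B n = {bs. length bs = n \<and> set bs \<subseteq> carrier B}"

definition multilinear_forms :: "('k::field, 'b) hopf_algebra \<Rightarrow> nat \<Rightarrow> ('b list \<Rightarrow> 'k) set" where
  "multilinear_forms B n = {T \<in> extensional (tuples B n).
     \<forall>bs \<in> tuples B n. \<forall>i < n. \<forall>x \<in> carrier B. \<forall>y \<in> carrier B. \<forall>c.
       T (bs[i := (c \<odot>\<^bsub>B\<^esub> x) \<oplus>\<^bsub>B\<^esub> y]) = c * T (bs[i := x]) + T (bs[i := y])}"

text \<open>
  Identities between tensors are tested against all multilinear forms, which separate the points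
  of a tensor power over a field.
\<close>

locale cocommutative_hopf_algebra =
  module "ring_of_type_algebra :: 'k ring" B + ring B
  for B :: "('k::field, 'b) hopf_algebra" (structure) +
  assumes smult_mult_left:
      "\<lbrakk>a \<in> carrier B; b \<in> carrier B\<rbrakk> \<Longrightarrow> (c \<odot> a) \<otimes> b = c \<odot> (a \<otimes> b)"
    and smult_mult_right:
      "\<lbrakk>a \<in> carrier B; b \<in> carrier B\<rbrakk> \<Longrightarrow> a \<otimes> (c \<odot> b) = c \<odot> (a \<otimes> b)"
    and comult_finite: "b \<in> carrier B \<Longrightarrow> finite (comult B b)"
    and comult_closed: "b \<in> carrier B \<Longrightarrow> comult B b \<subseteq> carrier B \<times> carrier B"
    and comult_linear:
      "\<lbrakk>T \<in> multilinear_forms B 2; a \<in> carrier B; b \<in> carrier B\<rbrakk> \<Longrightarrow>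
        (\<Sum>(x, y) \<in> comult B ((c \<odot> a) \<oplus> b). T [x, y]) =
        c * (\<Sum>(x, y) \<in> comult B a. T [x, y]) + (\<Sum>(x, y) \<in> comult B b. T [x, y])"
    and comult_mult:
      "\<lbrakk>T \<in> multilinear_forms B 2; a \<in> carrier B; b \<in> carrier B\<rbrakk> \<Longrightarrow>
        (\<Sum>(x, y) \<in> comult B (a \<otimes> b). T [x, y]) =
        (\<Sum>(x, y) \<in> comult B a. \<Sum>(u, v) \<in> comult B b. T [x \<otimes> u, y \<otimes> v])"
    and comult_one:
      "T \<in> multilinear_forms B 2 \<Longrightarrow> (\<Sum>(x, y) \<in> comult B \<one>. T [x, y]) = T [\<one>, \<one>]"
    and coassociative:
      "\<lbrakk>T \<in> multilinear_forms B 3; b \<in> carrier B\<rbrakk> \<Longrightarrow>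
        (\<Sum>(x, y) \<in> comult B b. \<Sum>(u, v) \<in> comult B x. T [u, v, y]) =
        (\<Sum>(x, y) \<in> comult B b. \<Sum>(u, v) \<in> comult B y. T [x, u, v])"
    and cocommutative:
      "\<lbrakk>T \<in> multilinear_forms B 2; b \<in> carrier B\<rbrakk> \<Longrightarrow>
        (\<Sum>(x, y) \<in> comult B b. T [x, y]) = (\<Sum>(x, y) \<in> comult B b. T [y, x])"
    and counit_linear:
      "\<lbrakk>a \<in> carrier B; b \<in> carrier B\<rbrakk> \<Longrightarrow>
        counit B ((c \<odot> a) \<oplus> b) = c * counit B a + counit B b"
    and counit_mult:
      "\<lbrakk>a \<in> carrier B; b \<in> carrier B\<rbrakk> \<Longrightarrow> counit B (a \<otimes> b) = counit B a * counit B b"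
    and counit_one: "counit B \<one> = 1"
    and counit_left:
      "b \<in> carrier B \<Longrightarrow> (\<Oplus>z \<in> comult B b. counit B (fst z) \<odot> snd z) = b"
    and counit_right:
      "b \<in> carrier B \<Longrightarrow> (\<Oplus>z \<in> comult B b. counit B (snd z) \<odot> fst z) = b"
    and antipode_closed: "b \<in> carrier B \<Longrightarrow> antipode B b \<in> carrier B"
    and antipode_linear:
      "\<lbrakk>a \<in> carrier B; b \<in> carrier B\<rbrakk> \<Longrightarrow>
        antipode B ((c \<odot> a) \<oplus> b) = (c \<odot> antipode B a) \<oplus> antipode B b"
    and antipode_left:
      "b \<in> carrier B \<Longrightarrow> (\<Oplus>z \<in> comult B b. antipode B (fst z) \<otimes> snd z) = counit B b \<odot> \<one>"
    and antipode_right: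
      "b \<in> carrier B \<Longrightarrow> (\<Oplus>z \<in> comult B b. fst z \<otimes> antipode B (snd z)) = counit B b \<odot> \<one>"

text \<open>
  \<open>listset (map (comult B) bs)\<close> enumerates the terms of \<open>\<Delta>(b\<^sub>1) \<otimes> \<dots> \<otimes> \<Delta>(b\<^sub>n)\<close>, so that
  \<open>(f * g)(b\<^sub>1, \<dots>, b\<^sub>n) = \<Sum> f(b\<^sub>1', \<dots>, b\<^sub>n') g(b\<^sub>1'', \<dots>, b\<^sub>n'')\<close>.
\<close>

definition convolution_monoid ::
    "('k::field, 'b) hopf_algebra \<Rightarrow> nat \<Rightarrow> ('b list \<Rightarrow> 'k) monoid" where
  "convolution_monoid B n =
     \<lparr>carrier = multilinear_forms B n,
      monoid.mult = (\<lambda>f g. \<lambda>bs \<in> tuples B n.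
        \<Sum>zs \<in> listset (map (comult B) bs). f (map fst zs) * g (map snd zs)),
      one = (\<lambda>bs \<in> tuples B n. prod_list (map (counit B) bs))\<rparr>"

definition sw_cochains :: "('k::field, 'b) hopf_algebra \<Rightarrow> nat \<Rightarrow> ('b list \<Rightarrow> 'k) monoid" where
  "sw_cochains B n = units_of (convolution_monoid B n)"

text \<open>
  The cofaces from degree \<open>n\<close> to degree \<open>n + 1\<close>, for \<open>i \<le> n + 1\<close>. The unit of \<open>B\<^sup>*\<close> is the counit
  of \<open>B\<close> and the comultiplication of \<open>B\<^sup>*\<close> is dual to the multiplication of \<open>B\<close>.
\<close>

definition sw_coface ::
    "('k::field, 'b) hopf_algebra \<Rightarrow> nat \<Rightarrow> nat \<Rightarrow> ('b list \<Rightarrow> 'k) \<Rightarrow> 'b list \<Rightarrow> 'k" where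
  "sw_coface B n i f = (\<lambda>bs \<in> tuples B (Suc n).
     if i = 0 then counit B (hd bs) * f (tl bs)
     else if i = Suc n then f (butlast bs) * counit B (last bs)
     else f (take (i - 1) bs @ [bs ! (i - 1) \<otimes>\<^bsub>B\<^esub> bs ! i] @ drop (Suc i) bs))"

definition sw_differential ::
    "('k::field, 'b) hopf_algebra \<Rightarrow> nat \<Rightarrow> ('b list \<Rightarrow> 'k) \<Rightarrow> 'b list \<Rightarrow> 'k" where
  "sw_differential B n f =
     (\<Otimes>\<^bsub>sw_cochains B (Suc n)\<^esub> i \<in> {..Suc n}.
        if even i then sw_coface B n i f
        else inv\<^bsub>sw_cochains B (Suc n)\<^esub> (sw_coface B n i f))"

definition sw_cocycles :: "('k::field, 'b) hopf_algebra \<Rightarrow> nat \<Rightarrow> ('b list \<Rightarrow> 'k) set" where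
  "sw_cocycles B n = kernel (sw_cochains B n) (sw_cochains B (Suc n)) (sw_differential B n)"

definition sw_coboundaries :: "('k::field, 'b) hopf_algebra \<Rightarrow> nat \<Rightarrow> ('b list \<Rightarrow> 'k) set" where
  "sw_coboundaries B n =
     (case n of 0 \<Rightarrow> {\<one>\<^bsub>sw_cochains B 0\<^esub>}
      | Suc m \<Rightarrow> sw_differential B m ` carrier (sw_cochains B m))"

definition sw_cohomology ::
    "('k::field, 'b) hopf_algebra \<Rightarrow> nat \<Rightarrow> ('b list \<Rightarrow> 'k) set monoid" where
  "sw_cohomology B n = (sw_cochains B n)\<lparr>carrier := sw_cocycles B n\<rparr> Mod sw_coboundaries B n"

text \<open>
  The Hopf algebra of \<open>k\<close>-valued functions on a finite group \<open>G\<close>, with pointwise multiplication. Its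
  comultiplication is determined by \<open>\<Delta>(f)(g, h) = f(g h)\<close> under \<open>O(G) \<otimes> O(G) = O(G \<times> G)\<close>; as a sum
  of elementary tensors, \<open>\<Delta>(f) = \<Sum>g \<in> G. \<delta>\<^sub>g \<otimes> f(g \<cdot>)\<close>.
\<close>

definition delta_fun :: "('g, 'm) monoid_scheme \<Rightarrow> 'g \<Rightarrow> 'g \<Rightarrow> 'k::field" where
  "delta_fun G g = (\<lambda>x \<in> carrier G. if x = g then 1 else 0)"

definition fun_hopf_algebra :: "('g, 'm) monoid_scheme \<Rightarrow> ('k::field, 'g \<Rightarrow> 'k) hopf_algebra" where
  "fun_hopf_algebra G =
     \<lparr>carrier = carrier G \<rightarrow>\<^sub>E UNIV,
      monoid.mult = (\<lambda>a b. \<lambda>x \<in> carrier G. a x * b x),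
      one = (\<lambda>x \<in> carrier G. 1),
      ring.zero = (\<lambda>x \<in> carrier G. 0),
      add = (\<lambda>a b. \<lambda>x \<in> carrier G. a x + b x),
      module.smult = (\<lambda>c a. \<lambda>x \<in> carrier G. c * a x),
      comult = (\<lambda>a. (\<lambda>g. (delta_fun G g, \<lambda>x \<in> carrier G. a (g \<otimes>\<^bsub>G\<^esub> x))) ` carrier G),
      counit = (\<lambda>a. a \<one>\<^bsub>G\<^esub>),
      antipode = (\<lambda>a. \<lambda>x \<in> carrier G. a (inv\<^bsub>G\<^esub> x))\<rparr>"

lemma fun_hopf_algebra_simps [simp]:
  "carrier (fun_hopf_algebra G) = carrier G \<rightarrow>\<^sub>E UNIV"
  "a \<otimes>\<^bsub>fun_hopf_algebra G\<^esub> b = (\<lambda>x \<in> carrier G. a x * b x)"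
  "\<one>\<^bsub>fun_hopf_algebra G\<^esub> = (\<lambda>x \<in> carrier G. 1)"
  "\<zero>\<^bsub>fun_hopf_algebra G\<^esub> = (\<lambda>x \<in> carrier G. 0)"
  "a \<oplus>\<^bsub>fun_hopf_algebra G\<^esub> b = (\<lambda>x \<in> carrier G. a x + b x)"
  "c \<odot>\<^bsub>fun_hopf_algebra G\<^esub> a = (\<lambda>x \<in> carrier G. c * a x)"
  "counit (fun_hopf_algebra G) a = a \<one>\<^bsub>G\<^esub>"
  "antipode (fun_hopf_algebra G) a = (\<lambda>x \<in> carrier G. a (inv\<^bsub>G\<^esub> x))"
  by (simp_all add: fun_hopf_algebra_def)

lemma delta_fun_inj: "inj_on (\<lambda>g. (delta_fun G g :: 'g \<Rightarrow> 'k::field, F g)) (carrier G)"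
proof (rule inj_onI)
  fix g h
  assume "g \<in> carrier G" "h \<in> carrier G"
    and "(delta_fun G g :: 'g \<Rightarrow> 'k, F g) = (delta_fun G h, F h)"
  then have "delta_fun G g g = (delta_fun G h g :: 'k)" by simp
  then show "g = h" using \<open>g \<in> carrier G\<close> by (simp add: delta_fun_def split: if_splits)
qed

lemma sum_comult_fun_hopf_algebra:
  "(\<Sum>(x, y) \<in> comult (fun_hopf_algebra G) (a :: 'g \<Rightarrow> 'k::field). F x y) =
   (\<Sum>g \<in> carrier G. F (delta_fun G g) (\<lambda>x \<in> carrier G. a (g \<otimes>\<^bsub>G\<^esub> x)))"
  by (simp add: fun_hopf_algebra_def sum.reindex[OF delta_fun_inj])

lemma multilinear_forms_sum:
  assumes T: "T \<in> multilinear_forms (fun_hopf_algebra G) n" and "finite A"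
    and bs: "bs \<in> tuples (fun_hopf_algebra G) n" and i: "i < n"
  shows "T (bs[i := (\<lambda>x \<in> carrier G. \<Sum>j \<in> A. c j * F j x)]) =
    (\<Sum>j \<in> A. c j * T (bs[i := restrict (F j) (carrier G)]))"
  using \<open>finite A\<close>
proof (induction A)
  case empty
  define z :: "'a \<Rightarrow> 'b" where "z = (\<lambda>x \<in> carrier G. 0)"
  have z: "z \<in> carrier (fun_hopf_algebra G)" by (simp add: z_def)
  have "T (bs[i := (1 \<odot>\<^bsub>fun_hopf_algebra G\<^esub> z) \<oplus>\<^bsub>fun_hopf_algebra G\<^esub> z]) =
      1 * T (bs[i := z]) + T (bs[i := z])"
    using T bs i z unfolding multilinear_forms_def by blast
  moreover have "(1 \<odot>\<^bsub>fun_hopf_algebra G\<^esub> z) \<oplus>\<^bsub>fun_hopf_algebra G\<^esub> z = z"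
    by (auto simp: z_def)
  ultimately have "T (bs[i := z]) = T (bs[i := z]) + T (bs[i := z])"
    by (simp only: mult_1)
  then have "T (bs[i := z]) = 0" by (simp only: add_cancel_right_right)
  then show ?case by (simp only: z_def sum.empty)
next
  case (insert j A)
  define u where "u = restrict (F j) (carrier G)"
  define v where "v = (\<lambda>x \<in> carrier G. \<Sum>j \<in> A. c j * F j x)"
  have "u \<in> carrier (fun_hopf_algebra G)" "v \<in> carrier (fun_hopf_algebra G)"
    by (simp_all add: u_def v_def)
  then have "T (bs[i := (c j \<odot>\<^bsub>fun_hopf_algebra G\<^esub> u) \<oplus>\<^bsub>fun_hopf_algebra G\<^esub> v]) =
      c j * T (bs[i := u]) + T (bs[i := v])"
    using T bs i unfolding multilinear_forms_def by blast
  moreover have "(c j \<odot>\<^bsub>fun_hopf_algebra G\<^esub> u) \<oplus>\<^bsub>fun_hopf_algebra G\<^esub> v =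
      (\<lambda>x \<in> carrier G. \<Sum>j \<in> insert j A. c j * F j x)"
    using insert.hyps by (auto simp: u_def v_def)
  ultimately have "T (bs[i := (\<lambda>x \<in> carrier G. \<Sum>j \<in> insert j A. c j * F j x)]) =
      c j * T (bs[i := u]) + T (bs[i := v])"
    by (simp only:)
  then show ?case using insert.IH by (simp only: u_def v_def sum.insert[OF insert.hyps])
qed

lemma ring_fun_hopf_algebra: "ring (fun_hopf_algebra G :: ('k::field, 'g \<Rightarrow> 'k) hopf_algebra)"
proof (rule ringI)
  show "abelian_group (fun_hopf_algebra G :: ('k, 'g \<Rightarrow> 'k) hopf_algebra)"
  proof (rule abelian_groupI)
    fix x :: "'g \<Rightarrow> 'k" assume "x \<in> carrier (fun_hopf_algebra G)"
    show "\<exists>y \<in> carrier (fun_hopf_algebra G).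
      y \<oplus>\<^bsub>fun_hopf_algebra G\<^esub> x = \<zero>\<^bsub>fun_hopf_algebra G\<^esub>"
      by (rule bexI[of _ "\<lambda>g \<in> carrier G. - x g"]) auto
  qed (auto simp: fun_eq_iff PiE_def extensional_def algebra_simps)
  show "monoid (fun_hopf_algebra G :: ('k, 'g \<Rightarrow> 'k) hopf_algebra)"
    by (rule monoidI) (auto simp: fun_eq_iff PiE_def extensional_def)
qed (auto simp: fun_eq_iff algebra_simps)

lemma finsum_fun_hopf_algebra:
  fixes F :: "'j \<Rightarrow> 'g \<Rightarrow> 'k::field"
  assumes "finite A"
  shows "(\<Oplus>\<^bsub>fun_hopf_algebra G\<^esub> j \<in> A. (\<lambda>x \<in> carrier G. F j x)) =
    (\<lambda>x \<in> carrier G. \<Sum>j \<in> A. F j x)"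
proof -
  interpret ring "fun_hopf_algebra G :: ('k, 'g \<Rightarrow> 'k) hopf_algebra" by (rule ring_fun_hopf_algebra)
  show ?thesis using assms
  proof (induction A)
    case empty
    show ?case by (subst finsum_empty) simp
  next
    case (insert j A)
    have "(\<Oplus>\<^bsub>fun_hopf_algebra G\<^esub> j \<in> insert j A. (\<lambda>x \<in> carrier G. F j x)) =
      (\<lambda>x \<in> carrier G. F j x) \<oplus>\<^bsub>fun_hopf_algebra G\<^esub>
        (\<Oplus>\<^bsub>fun_hopf_algebra G\<^esub> j \<in> A. (\<lambda>x \<in> carrier G. F j x))"
      by (rule finsum_insert) (use insert.hyps in auto)
    also have "\<dots> = (\<lambda>x \<in> carrier G. \<Sum>j \<in> insert j A. F j x)"
      unfolding insert.IH using insert.hyps by (auto simp: fun_eq_iff)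
    finally show ?case .
  qed
qed

lemma finsum_comult_fun_hopf_algebra:
  fixes a :: "'g \<Rightarrow> 'k::field"
  assumes "finite (carrier G)"
  shows "(\<Oplus>\<^bsub>fun_hopf_algebra G\<^esub> z \<in> comult (fun_hopf_algebra G) a.
      (\<lambda>x \<in> carrier G. F (fst z) (snd z) x)) =
    (\<lambda>x \<in> carrier G. \<Sum>g \<in> carrier G. F (delta_fun G g) (\<lambda>x \<in> carrier G. a (g \<otimes>\<^bsub>G\<^esub> x)) x)"
proof -
  have "finite (comult (fun_hopf_algebra G) a)"
    using assms by (simp add: fun_hopf_algebra_def)
  from finsum_fun_hopf_algebra[OF this, of G "\<lambda>z. F (fst z) (snd z)"]
  show ?thesis
    using sum_comult_fun_hopf_algebra[of "\<lambda>u v. F u v _" G a] by (simp add: case_prod_beta)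
qed

lemma cocommutative_fun_hopf_algebra:
  assumes "comm_group G" and fin: "finite (carrier G)"
  shows "cocommutative_hopf_algebra (fun_hopf_algebra G :: ('k::field, 'g \<Rightarrow> 'k) hopf_algebra)"
proof -
  interpret G: comm_group G by fact
  let ?B = "fun_hopf_algebra G :: ('k, 'g \<Rightarrow> 'k) hopf_algebra"
  let ?d = "delta_fun G :: 'g \<Rightarrow> 'g \<Rightarrow> 'k"
  interpret ring ?B by (rule ring_fun_hopf_algebra)
  have module: "module (ring_of_type_algebra :: 'k ring) ?B"
    by (rule moduleI)
      (auto simp: fun_eq_iff PiE_def extensional_def algebra_simps ring_of_type_algebra_def
        intro: cring_from_type_algebra[unfolded ring_of_type_algebra_def] abelian_group_axioms)
  have d_closed: "?d g \<in> carrier G \<rightarrow>\<^sub>E UNIV" for g by (simp add: delta_fun_def)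
  have restrict_d: "restrict (?d g) (carrier G) = ?d g" for g by (simp add: delta_fun_def)
  have expand: "restrict b (carrier G) = (\<lambda>x \<in> carrier G. \<Sum>g \<in> carrier G. b g * ?d g x)"
    for b :: "'g \<Rightarrow> 'k"
    using fin
    by (auto simp: fun_eq_iff delta_fun_def sum.delta if_distrib[of "\<lambda>u. _ * u"] cong: if_cong)
  have slot: "T (bs[i := restrict b (carrier G)]) = (\<Sum>g \<in> carrier G. b g * T (bs[i := ?d g]))"
    if "T \<in> multilinear_forms ?B n" "bs \<in> tuples ?B n" "i < n" for T n bs i and b :: "'g \<Rightarrow> 'k"
    by (subst expand, subst multilinear_forms_sum[OF that(1) fin that(2,3)]) (simp add: restrict_d)
  have slot1: "T [restrict a (carrier G), b] = (\<Sum>g \<in> carrier G. a g * T [?d g, b])"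
    if "T \<in> multilinear_forms ?B 2" "b \<in> carrier G \<rightarrow>\<^sub>E UNIV" for T a b
    using slot[OF that(1), of "[b, b]" 0 a] that(2) by (simp add: tuples_def)
  have slot2: "T [a, restrict b (carrier G)] = (\<Sum>g \<in> carrier G. b g * T [a, ?d g])"
    if "T \<in> multilinear_forms ?B 2" "a \<in> carrier G \<rightarrow>\<^sub>E UNIV" for T a b
    using slot[OF that(1), of "[a, a]" 1 b] that(2) by (simp add: tuples_def)
  have shift_d: "(\<lambda>x \<in> carrier G. ?d g (h \<otimes>\<^bsub>G\<^esub> x)) = ?d (inv\<^bsub>G\<^esub> h \<otimes>\<^bsub>G\<^esub> g)"
    if "g \<in> carrier G" "h \<in> carrier G" for g h
    using that by (auto simp: fun_eq_iff delta_fun_def G.inv_solve_left G.m_assoc[symmetric])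
  have form: "(\<Sum>(x, y) \<in> comult ?B a. T [x, y]) =
      (\<Sum>g \<in> carrier G. \<Sum>h \<in> carrier G. a (g \<otimes>\<^bsub>G\<^esub> h) * T [?d g, ?d h])"
    if "T \<in> multilinear_forms ?B 2" for T a
    unfolding sum_comult_fun_hopf_algebra by (simp add: slot2[OF that d_closed])
  show ?thesis
  proof (intro cocommutative_hopf_algebra.intro cocommutative_hopf_algebra_axioms.intro
      module ring_axioms)
    fix T :: "('g \<Rightarrow> 'k) list \<Rightarrow> 'k" and a b :: "'g \<Rightarrow> 'k" and c :: 'k
    show "finite (comult ?B b)" "comult ?B b \<subseteq> carrier ?B \<times> carrier ?B"
      using fin by (auto simp: fun_hopf_algebra_def delta_fun_def)
    show "(\<Oplus>\<^bsub>?B\<^esub>z \<in> comult ?B b. counit ?B (fst z) \<odot>\<^bsub>?B\<^esub> snd z) = b"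
      if "b \<in> carrier ?B"
      using that fin
      by (simp add: finsum_comult_fun_hopf_algebra[OF fin, where F = "\<lambda>u v x. u \<one>\<^bsub>G\<^esub> * v x"])
        (auto simp: fun_eq_iff delta_fun_def PiE_def extensional_def if_distribR sum.delta
          if_distrib[of "\<lambda>u. u * _"] cong: if_cong)
    show "(\<Oplus>\<^bsub>?B\<^esub>z \<in> comult ?B b. counit ?B (snd z) \<odot>\<^bsub>?B\<^esub> fst z) = b"
      if "b \<in> carrier ?B"
      using that fin
      by (simp add: finsum_comult_fun_hopf_algebra[OF fin, where F = "\<lambda>u v x. v \<one>\<^bsub>G\<^esub> * u x"])
        (auto simp: fun_eq_iff delta_fun_def PiE_def extensional_def sum.delta
          if_distrib[of "\<lambda>u. _ * u"] cong: if_cong)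
    show "(\<Oplus>\<^bsub>?B\<^esub>z \<in> comult ?B b. antipode ?B (fst z) \<otimes>\<^bsub>?B\<^esub> snd z) = counit ?B b \<odot>\<^bsub>?B\<^esub> \<one>\<^bsub>?B\<^esub>"
      if "b \<in> carrier ?B"
    proof -
      have "(\<Oplus>\<^bsub>?B\<^esub>z \<in> comult ?B b. antipode ?B (fst z) \<otimes>\<^bsub>?B\<^esub> snd z) =
        (\<Oplus>\<^bsub>?B\<^esub>z \<in> comult ?B b. (\<lambda>x \<in> carrier G. fst z (inv\<^bsub>G\<^esub> x) * snd z x))"
        by (rule arg_cong[where f = "\<lambda>f. finsum ?B f _"]) (auto simp: fun_eq_iff)
      also have "\<dots> = (\<lambda>x \<in> carrier G. b \<one>\<^bsub>G\<^esub>)"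
        using fin
        by (simp add: finsum_comult_fun_hopf_algebra[OF fin, where F = "\<lambda>u v x. u (inv\<^bsub>G\<^esub> x) * v x"])
          (auto simp: fun_eq_iff delta_fun_def sum.delta if_distrib[of "\<lambda>u. u * _"] cong: if_cong)
      finally show ?thesis by (auto simp: fun_eq_iff)
    qed
    show "(\<Oplus>\<^bsub>?B\<^esub>z \<in> comult ?B b. fst z \<otimes>\<^bsub>?B\<^esub> antipode ?B (snd z)) = counit ?B b \<odot>\<^bsub>?B\<^esub> \<one>\<^bsub>?B\<^esub>"
      if "b \<in> carrier ?B"
    proof -
      have "(\<Oplus>\<^bsub>?B\<^esub>z \<in> comult ?B b. fst z \<otimes>\<^bsub>?B\<^esub> antipode ?B (snd z)) =
        (\<Oplus>\<^bsub>?B\<^esub>z \<in> comult ?B b. (\<lambda>x \<in> carrier G. fst z x * snd z (inv\<^bsub>G\<^esub> x)))"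
        by (rule arg_cong[where f = "\<lambda>f. finsum ?B f _"]) (auto simp: fun_eq_iff)
      also have "\<dots> = (\<lambda>x \<in> carrier G. b \<one>\<^bsub>G\<^esub>)"
        using fin
        by (simp add: finsum_comult_fun_hopf_algebra[OF fin, where F = "\<lambda>u v x. u x * v (inv\<^bsub>G\<^esub> x)"])
          (auto simp: fun_eq_iff delta_fun_def sum.delta if_distrib[of "\<lambda>u. u * _"] cong: if_cong)
      finally show ?thesis by (auto simp: fun_eq_iff)
    qed
    show "(\<Sum>(x, y) \<in> comult ?B b. \<Sum>(u, v) \<in> comult ?B x. T [u, v, y]) =
        (\<Sum>(x, y) \<in> comult ?B b. \<Sum>(u, v) \<in> comult ?B y. T [x, u, v])"
    proof -
      let ?s = "\<lambda>g. \<lambda>x \<in> carrier G. b (g \<otimes>\<^bsub>G\<^esub> x)"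
      have "(\<Sum>(x, y) \<in> comult ?B b. \<Sum>(u, v) \<in> comult ?B x. T [u, v, y]) =
        (\<Sum>g \<in> carrier G. \<Sum>h \<in> carrier G. T [?d h, ?d (inv\<^bsub>G\<^esub> h \<otimes>\<^bsub>G\<^esub> g), ?s g])"
        by (simp add: sum_comult_fun_hopf_algebra shift_d)
      also have "\<dots> = (\<Sum>h \<in> carrier G. \<Sum>g \<in> carrier G. T [?d h, ?d (inv\<^bsub>G\<^esub> h \<otimes>\<^bsub>G\<^esub> g), ?s g])"
        by (rule sum.swap)
      also have "\<dots> = (\<Sum>h \<in> carrier G. \<Sum>g \<in> carrier G. T [?d h, ?d g, ?s (h \<otimes>\<^bsub>G\<^esub> g)])"
      proof (rule sum.cong[OF refl])
        fix h assume h: "h \<in> carrier G"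
        show "(\<Sum>g \<in> carrier G. T [?d h, ?d (inv\<^bsub>G\<^esub> h \<otimes>\<^bsub>G\<^esub> g), ?s g]) =
            (\<Sum>g \<in> carrier G. T [?d h, ?d g, ?s (h \<otimes>\<^bsub>G\<^esub> g)])"
          by (rule sum.reindex_bij_witness[of _ "\<lambda>g. h \<otimes>\<^bsub>G\<^esub> g" "\<lambda>g. inv\<^bsub>G\<^esub> h \<otimes>\<^bsub>G\<^esub> g"])
            (use h in \<open>simp_all add: G.m_assoc[symmetric]\<close>)
      qed
      also have "\<dots> = (\<Sum>(x, y) \<in> comult ?B b. \<Sum>(u, v) \<in> comult ?B y. T [x, u, v])"
        by (simp add: sum_comult_fun_hopf_algebra G.m_assoc cong: restrict_cong)
      finally show ?thesis .
    qed
    assume T: "T \<in> multilinear_forms ?B 2"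
    show "(\<Sum>(x, y) \<in> comult ?B ((c \<odot>\<^bsub>?B\<^esub> a) \<oplus>\<^bsub>?B\<^esub> b). T [x, y]) =
        c * (\<Sum>(x, y) \<in> comult ?B a. T [x, y]) + (\<Sum>(x, y) \<in> comult ?B b. T [x, y])"
      by (simp add: form[OF T] sum_distrib_left sum.distrib algebra_simps)
    show "(\<Sum>(x, y) \<in> comult ?B \<one>\<^bsub>?B\<^esub>. T [x, y]) = T [\<one>\<^bsub>?B\<^esub>, \<one>\<^bsub>?B\<^esub>]"
      by (simp add: form[OF T] slot1[OF T] slot2[OF T d_closed])
    show "(\<Sum>(x, y) \<in> comult ?B b. T [x, y]) = (\<Sum>(x, y) \<in> comult ?B b. T [y, x])"
    proof -
      have "(\<Sum>(x, y) \<in> comult ?B b. T [y, x]) =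
        (\<Sum>g \<in> carrier G. \<Sum>h \<in> carrier G. b (g \<otimes>\<^bsub>G\<^esub> h) * T [?d h, ?d g])"
        unfolding sum_comult_fun_hopf_algebra by (simp add: slot1[OF T d_closed])
      also have "\<dots> = (\<Sum>g \<in> carrier G. \<Sum>h \<in> carrier G. b (h \<otimes>\<^bsub>G\<^esub> g) * T [?d g, ?d h])"
        by (rule sum.swap)
      finally show ?thesis by (simp add: form[OF T] G.m_comm)
    qed
    show "(\<Sum>(x, y) \<in> comult ?B (a \<otimes>\<^bsub>?B\<^esub> b). T [x, y]) =
        (\<Sum>(x, y) \<in> comult ?B a. \<Sum>(u, v) \<in> comult ?B b. T [x \<otimes>\<^bsub>?B\<^esub> u, y \<otimes>\<^bsub>?B\<^esub> v])"
    proof -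
      have dd: "(\<lambda>x \<in> carrier G. ?d g x * ?d h x) =
          restrict (\<lambda>x. if g = h then ?d g x else 0) (carrier G)" for g h
        by (auto simp: fun_eq_iff delta_fun_def)
      have "(\<Sum>(x, y) \<in> comult ?B a. \<Sum>(u, v) \<in> comult ?B b. T [x \<otimes>\<^bsub>?B\<^esub> u, y \<otimes>\<^bsub>?B\<^esub> v]) =
        (\<Sum>g \<in> carrier G. \<Sum>h \<in> carrier G. if h = g then
           T [?d g, \<lambda>x \<in> carrier G. a (g \<otimes>\<^bsub>G\<^esub> x) * b (g \<otimes>\<^bsub>G\<^esub> x)] else 0)"
      proof -
        have "T [\<lambda>x \<in> carrier G. ?d g x * ?d h x, y] = (if h = g then T [?d g, y] else 0)"
          if "y \<in> carrier G \<rightarrow>\<^sub>E UNIV" for g h y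
          using slot1[OF T that, of "\<lambda>_. 0"] by (auto simp: dd restrict_d)
        then show ?thesis
          by (simp add: sum_comult_fun_hopf_algebra cong: restrict_cong if_cong)
      qed
      also have "\<dots> = (\<Sum>g \<in> carrier G. T [?d g, \<lambda>x \<in> carrier G. a (g \<otimes>\<^bsub>G\<^esub> x) * b (g \<otimes>\<^bsub>G\<^esub> x)])"
        using fin by simp
      finally show ?thesis
        by (simp add: sum_comult_fun_hopf_algebra cong: restrict_cong)
    qed
  qed (auto simp: fun_eq_iff algebra_simps)
qed

end

theory Submission
  imports Defs "HOL-Library.Poly_Mapping" "HOL-Library.Function_Algebras"
begin

text \<open>
  Write \<open>G\<close> for the cyclic group of order \<open>p\<close>. The convolution algebra of \<open>n\<close>-cochains is the group
  algebra \<open>A\<^sub>n = k[G\<^sup>n]\<close>, and the cofaces are induced by group homomorphisms \<open>G\<^sup>n \<rightarrow> G\<^sup>n\<^sup>+\<^sup>1\<close>.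
  Integrating the logarithmic derivative \<open>f \<mapsto> df / f\<close> of a unit along the invariant derivations
  \<open>x\<^sub>i \<partial>/\<partial>x\<^sub>i\<close> gives an exact sequence of cosimplicial abelian groups
  \<open>1 \<rightarrow> k\<^sup>* \<times> G\<^sup>n \<rightarrow> A\<^sub>n\<^sup>* \<rightarrow> A\<^sub>n / k \<rightarrow> 0\<close>, where surjectivity uses that \<open>k\<close> is algebraically closed.
  The additive complex on the right is contracted by taking the part of weight zero in the first
  variable, so the cohomology is that of \<open>k\<^sup>* \<times> G\<^sup>n\<close>, which in positive degrees is \<open>G\<close> in degree 1.
\<close>

section \<open>The group algebra and its cofaces\<close>

text \<open>The contraction kills every monomial of nonzero weight in the first variable. It is
  linear but not multiplicative and cannot act on units, so logarithmic derivatives carry the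
  problem to a complex where linear maps suffice. In characteristic \<open>p\<close> no exponential
  series leads back. A unit with potential \<open>t x^m\<close> is built by hand instead; the
  obstruction is the Artin-Schreier equation \<open>c - c^p = t^p\<close>, whose unknown
  \<open>c\<close> is the freedom left by working up to constant forms. The kernel is small because
  exponents are weights: a joint eigenvector of all the derivations has a single exponent, so it is
  a monomial. In the remaining complex of monomials \<open>c x^m\<close> the scalars form a constant
  cosimplicial group, with cohomology in degree 0 only. The exponents leave only a power of the
  first variable, which is a nontrivial class in degree 1 and a coboundary in every higher degree
  where it is a cocycle.\<close>

text \<open>
  Monomials have exponents in \<open>k\<close> itself, so that the weights of the derivations are the exponents
  and \<open>G\<close> becomes the prime field \<open>\<int> \<subseteq> k\<close>; \<open>supported n\<close> is the copy of \<open>k[G\<^sup>n]\<close>. With \<open>x\<^sup>m\<close> in \<open>n\<close> variables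
  padded by zeros, a single formula covers all cofaces, the last one being the inclusion.
\<close>

type_synonym 'k galg = "(nat \<Rightarrow> 'k) \<Rightarrow>\<^sub>0 'k"

abbreviation grouplike :: "(nat \<Rightarrow> 'k) \<Rightarrow> 'k::field galg" where
  "grouplike m \<equiv> Poly_Mapping.single m 1"

abbreviation const :: "'k \<Rightarrow> 'k::field galg" where
  "const c \<equiv> Poly_Mapping.single 0 c"

definition lin :: "((nat \<Rightarrow> 'k) \<Rightarrow> 'k galg) \<Rightarrow> 'k::field galg \<Rightarrow> 'k galg" where
  "lin F f = (\<Sum>m \<in> Poly_Mapping.keys f. const (Poly_Mapping.lookup f m) * F m)"

lemma lin_superset:
  assumes "finite K" "Poly_Mapping.keys f \<subseteq> K"
  shows "lin F f = (\<Sum>m \<in> K. const (Poly_Mapping.lookup f m) * F m)"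
  unfolding lin_def by (rule sum.mono_neutral_left) (use assms in \<open>auto simp: in_keys_iff\<close>)

lemma lin_add: "lin F (f + g) = lin F f + lin F g"
proof -
  let ?K = "Poly_Mapping.keys f \<union> Poly_Mapping.keys g"
  have "Poly_Mapping.keys (f + g) \<subseteq> ?K" by (rule keys_add)
  then show ?thesis
    by (simp add: lin_superset[of ?K] lookup_add single_add distrib_right sum.distrib)
qed

lemma lin_zero [simp]: "lin F 0 = 0"
  by (simp add: lin_def)

lemma lin_uminus: "lin F (- f) = - lin F f"
  by (metis add.right_inverse add_eq_0_iff lin_add lin_zero)

lemma lin_sum: "lin F (sum f I) = (\<Sum>i \<in> I. lin F (f i))"
  by (induction I rule: infinite_finite_induct) (auto simp: lin_add)

lemma lin_single: "lin F (Poly_Mapping.single m c) = const c * F m"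
  by (simp add: lin_def)

lemma sum_single_lookup:
  "(\<Sum>m \<in> Poly_Mapping.keys f. Poly_Mapping.single m (Poly_Mapping.lookup f m)) = f"
  by (rule poly_mapping_eqI) (simp add: lookup_sum lookup_single when_def in_keys_iff)

text \<open>Identities between linear maps need checking on monomials only. Zero has no case of its
  own because it is \<open>Poly_Mapping.single 0 0\<close>.\<close>

lemma galg_induct [case_names single add]:
  fixes f :: "'k::field galg"
  assumes "\<And>m c. P (Poly_Mapping.single m c)"
    and "\<And>f g. P f \<Longrightarrow> P g \<Longrightarrow> P (f + g)"
  shows "P f"
proof -
  have "finite K \<Longrightarrow> P (\<Sum>m \<in> K. Poly_Mapping.single m (Poly_Mapping.lookup f m))" for K
  proof (induction K rule: finite_induct)
    case empty
    show ?case using assms(1)[of 0 0] by simp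
  qed (simp add: assms)
  from this[OF finite_keys, of f] show ?thesis by (simp only: sum_single_lookup)
qed

text \<open>An additive map of exponents is a group homomorphism, so its linear extension is a ring
  homomorphism of group algebras.\<close>

lemma lin_grouplike_mult:
  assumes "\<And>m m'. h (m + m') = h m + h m'"
  shows "lin (\<lambda>m. grouplike (h m)) (f * g) = lin (\<lambda>m. grouplike (h m)) f * lin (\<lambda>m. grouplike (h m)) g"
proof (induction f rule: galg_induct)
  case (single m c)
  show ?case
    by (induction g rule: galg_induct)
      (simp_all add: mult_single lin_single assms lin_add distrib_left)
qed (simp add: lin_add distrib_right)

section \<open>Elements involving only the first n variables\<close>

definition supported :: "nat \<Rightarrow> 'k::field galg set" where
  "supported n = {f. \<forall>m \<in> Poly_Mapping.keys f. (\<forall>j. m j \<in> \<int>) \<and> (\<forall>j \<ge> n. m j = 0)}"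

lemma supported_zero [simp]: "0 \<in> supported n"
  by (simp add: supported_def)

lemma supported_add: "f \<in> supported n \<Longrightarrow> g \<in> supported n \<Longrightarrow> f + g \<in> supported n"
  using keys_add[of f g] by (fastforce simp: supported_def)

lemma supported_mult: "f \<in> supported n \<Longrightarrow> g \<in> supported n \<Longrightarrow> f * g \<in> supported n"
  using keys_mult[of f g] by (fastforce simp: supported_def)

lemma supported_single:
  "(\<And>j. m j \<in> \<int>) \<Longrightarrow> (\<And>j. j \<ge> n \<Longrightarrow> m j = 0) \<Longrightarrow> Poly_Mapping.single m c \<in> supported n"
  by (simp add: supported_def)

lemma supported_const [simp]: "const c \<in> supported n"
  by (rule supported_single) auto

lemma supported_one [simp]: "1 \<in> supported n"
  using supported_const[of 1 n] by simp

lemma supported_sum: "(\<And>i. i \<in> I \<Longrightarrow> f i \<in> supported n) \<Longrightarrow> sum f I \<in> supported n"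
  by (induction I rule: infinite_finite_induct) (auto simp: supported_add)

lemma supported_lin:
  "(\<And>m. m \<in> Poly_Mapping.keys f \<Longrightarrow> F m \<in> supported n) \<Longrightarrow> lin F f \<in> supported n"
  unfolding lin_def by (intro supported_sum supported_mult) auto

section \<open>Units and inverses\<close>

definition inverse_of :: "'a::comm_ring_1 \<Rightarrow> 'a" where
  "inverse_of x = (SOME y. x * y = 1)"

text \<open>The choice is made in the whole ring; by uniqueness it agrees with the inverse inside
  any \<open>supported n\<close>, so one degree-free \<open>inverse_of\<close> serves all
  degrees.\<close>

lemma inverse_of_unique: "x * y = 1 \<Longrightarrow> inverse_of x = y"
  unfolding inverse_of_def by (rule some_equality) (auto, metis mult.assoc mult.commute mult_1)

definition units_in :: "nat \<Rightarrow> 'k::field galg set" where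
  "units_in n = {x \<in> supported n. \<exists>y \<in> supported n. x * y = 1}"

lemma units_inI: "x \<in> supported n \<Longrightarrow> y \<in> supported n \<Longrightarrow> x * y = 1 \<Longrightarrow> x \<in> units_in n"
  by (auto simp: units_in_def)

lemma units_inE:
  assumes "x \<in> units_in n"
  obtains "x \<in> supported n" "x * inverse_of x = 1" "inverse_of x \<in> units_in n"
proof -
  from assms obtain y where y: "x \<in> supported n" "y \<in> supported n" "x * y = 1"
    by (auto simp: units_in_def)
  moreover from y have "inverse_of x = y" by (intro inverse_of_unique)
  ultimately show ?thesis by (intro that units_inI[of "inverse_of x" n x]) (auto simp: mult.commute)
qed

lemma units_in_one [simp]: "1 \<in> units_in n"
  by (rule units_inI[of _ _ 1]) auto

lemma units_in_mult:
  assumes "x \<in> units_in n" "y \<in> units_in n"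
  shows "x * y \<in> units_in n"
proof -
  from assms obtain x' y' where s: "x \<in> supported n" "y \<in> supported n"
      "x' \<in> supported n" "y' \<in> supported n" and inv: "x * x' = 1" "y * y' = 1"
    by (auto simp: units_in_def)
  have "x * y * (x' * y') = (x * x') * (y * y')" by (simp only: mult_ac)
  also have "\<dots> = 1" by (simp only: inv mult_1)
  finally show ?thesis by (rule units_inI[OF supported_mult[OF s(1,2)] supported_mult[OF s(3,4)]])
qed

lemma units_in_inverse: "x \<in> units_in n \<Longrightarrow> inverse_of x \<in> units_in n"
  by (erule units_inE)

lemma units_in_right_inverse: "x \<in> units_in n \<Longrightarrow> x * inverse_of x = 1"
  by (erule units_inE)

lemma inverse_of_mult:
  assumes "x \<in> units_in n" "y \<in> units_in n"
  shows "inverse_of (x * y) = inverse_of x * inverse_of y"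
proof (rule inverse_of_unique)
  have "x * y * (inverse_of x * inverse_of y) = (x * inverse_of x) * (y * inverse_of y)"
    by (simp only: mult_ac)
  then show "x * y * (inverse_of x * inverse_of y) = 1"
    using assms by (simp add: units_in_right_inverse)
qed

lemma units_in_prod: "(\<And>i. i \<in> I \<Longrightarrow> f i \<in> units_in n) \<Longrightarrow> prod f I \<in> units_in n"
  by (induction I rule: infinite_finite_induct) (auto simp: units_in_mult)

lemma inverse_of_prod:
  "(\<And>i. i \<in> I \<Longrightarrow> f i \<in> units_in n) \<Longrightarrow> inverse_of (prod f I) = (\<Prod>i \<in> I. inverse_of (f i))"
  by (induction I rule: infinite_finite_induct)
    (auto simp: inverse_of_mult[where n = n] units_in_prod inverse_of_unique)

lemma units_in_single:
  assumes "\<And>j. m j \<in> \<int>" "\<And>j. j \<ge> n \<Longrightarrow> m j = 0" "c \<noteq> 0"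
  shows "Poly_Mapping.single m c \<in> units_in n"
  by (rule units_inI[of _ _ "Poly_Mapping.single (- m) (1 / c)"])
    (use assms in \<open>auto simp: mult_single intro!: supported_single\<close>)

lemma inverse_of_single:
  "c \<noteq> 0 \<Longrightarrow> inverse_of (Poly_Mapping.single m c :: 'k::field galg) = Poly_Mapping.single (- m) (1 / c)"
  by (rule inverse_of_unique) (simp add: mult_single)

section \<open>Cofaces and the cosimplicial identity\<close>

definition coface_exp :: "nat \<Rightarrow> (nat \<Rightarrow> 'k) \<Rightarrow> nat \<Rightarrow> 'k::field" where
  "coface_exp i m = (\<lambda>j. if j < i then m j else if j = 0 then 0 else m (j - 1))"

text \<open>\<open>coface_exp 0\<close> puts a zero in front, and \<open>coface_exp i\<close> with
  \<open>i > 0\<close> repeats position \<open>i - 1\<close>. If \<open>m\<close> vanishes from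
  \<open>n\<close> on, then \<open>i = Suc n\<close> merely repeats a zero and fixes
  \<open>m\<close>.\<close>

definition coface :: "nat \<Rightarrow> 'k::field galg \<Rightarrow> 'k galg" where
  "coface i = lin (\<lambda>m. grouplike (coface_exp i m))"

lemma coface_exp_add: "coface_exp i (m + m') = coface_exp i m + coface_exp i m'"
  by (auto simp: coface_exp_def)

lemma coface_exp_zero [simp]: "coface_exp i 0 = 0"
  by (auto simp: coface_exp_def)

lemma coface_exp_coface_exp:
  "i \<le> j \<Longrightarrow> coface_exp (Suc j) (coface_exp i m) = coface_exp i (coface_exp j m)"
  by (auto simp: coface_exp_def fun_eq_iff)

lemma coface_single [simp]:
  "coface i (Poly_Mapping.single m c) = Poly_Mapping.single (coface_exp i m) c"
  by (simp add: coface_def lin_single mult_single)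

lemma coface_add: "coface i (f + g) = coface i f + coface i g"
  by (simp add: coface_def lin_add)

lemma coface_mult: "coface i (f * g) = coface i f * coface i g"
  unfolding coface_def by (rule lin_grouplike_mult) (rule coface_exp_add)

lemma coface_one [simp]: "coface i 1 = 1"
  using coface_single[of i 0 1] by simp

lemma coface_prod: "coface i (prod f I) = (\<Prod>j \<in> I. coface i (f j))"
  by (induction I rule: infinite_finite_induct) (auto simp: coface_mult)

lemma coface_coface: "i \<le> j \<Longrightarrow> coface (Suc j) (coface i f) = coface i (coface j f)"
  by (induction f rule: galg_induct) (simp_all add: coface_exp_coface_exp coface_add)

lemma coface_supported: "f \<in> supported n \<Longrightarrow> coface i f \<in> supported (Suc n)"
  unfolding coface_def
  by (rule supported_lin, rule supported_single) (auto simp: supported_def coface_exp_def)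

lemma coface_units_in: "x \<in> units_in n \<Longrightarrow> coface i x \<in> units_in (Suc n)"
  by (erule units_inE, rule units_inI[of _ _ "coface i (inverse_of x)"])
    (auto simp: coface_supported units_in_def simp flip: coface_mult)

lemma coface_inverse_of: "x \<in> units_in n \<Longrightarrow> coface i (inverse_of x) = inverse_of (coface i x)"
  by (metis coface_mult coface_one inverse_of_unique units_in_right_inverse)

section \<open>The multiplicative differential\<close>

definition sgn_pow :: "nat \<Rightarrow> 'a::comm_ring_1 \<Rightarrow> 'a" where
  "sgn_pow i x = (if even i then x else inverse_of x)"

definition differential :: "nat \<Rightarrow> 'k::field galg \<Rightarrow> 'k galg" where
  "differential n x = (\<Prod>i \<le> Suc n. sgn_pow i (coface i x))"

lemma sgn_pow_units_in: "x \<in> units_in n \<Longrightarrow> sgn_pow i x \<in> units_in n"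
  by (simp add: sgn_pow_def units_in_inverse)

lemma sgn_pow_mult:
  "x \<in> units_in n \<Longrightarrow> y \<in> units_in n \<Longrightarrow> sgn_pow i (x * y) = sgn_pow i x * sgn_pow i y"
  by (simp add: sgn_pow_def inverse_of_mult)

lemma sgn_pow_prod:
  "(\<And>j. j \<in> I \<Longrightarrow> f j \<in> units_in n) \<Longrightarrow> sgn_pow i (prod f I) = (\<Prod>j \<in> I. sgn_pow i (f j))"
  by (simp add: sgn_pow_def inverse_of_prod[where n = n])

lemma differential_units_in: "x \<in> units_in n \<Longrightarrow> differential n x \<in> units_in (Suc n)"
  unfolding differential_def by (intro units_in_prod sgn_pow_units_in coface_units_in)

lemma differential_mult:
  "x \<in> units_in n \<Longrightarrow> y \<in> units_in n \<Longrightarrow>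
    differential n (x * y) = differential n x * differential n y"
  unfolding differential_def coface_mult
  by (simp add: sgn_pow_mult[where n = "Suc n"] coface_units_in prod.distrib)

lemma differential_differential:
  assumes x: "x \<in> units_in n"
  shows "differential (Suc n) (differential n x) = 1"
proof -
  define g where "g = (\<lambda>(j, i). sgn_pow j (sgn_pow i (coface j (coface i x))))"
  let ?I = "{..Suc (Suc n)} \<times> {..Suc n}"
  let ?L = "{(j, i). j \<le> Suc (Suc n) \<and> i < j}"
  let ?R = "{(j, i). i \<le> Suc n \<and> j \<le> i}"
  have u: "coface j (coface i x) \<in> units_in (Suc (Suc n))" for i j
    by (intro coface_units_in x)
  have "differential (Suc n) (differential n x) = (\<Prod>j \<le> Suc (Suc n). \<Prod>i \<le> Suc n. g (j, i))"
    unfolding differential_def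
  proof (rule prod.cong[OF refl])
    fix j
    have "coface j (\<Prod>i \<le> Suc n. sgn_pow i (coface i x)) =
        (\<Prod>i \<le> Suc n. sgn_pow i (coface j (coface i x)))"
      unfolding coface_prod
      by (rule prod.cong) (auto simp: sgn_pow_def coface_inverse_of[OF coface_units_in[OF x]])
    then show "sgn_pow j (coface j (\<Prod>i \<le> Suc n. sgn_pow i (coface i x))) = (\<Prod>i \<le> Suc n. g (j, i))"
      unfolding g_def
      by (simp only: prod.case) (rule sgn_pow_prod, rule sgn_pow_units_in, rule u)
  qed
  also have "\<dots> = prod g ?I"
    by (simp only: prod.cartesian_product case_prod_eta)
  also have "?I = ?L \<union> ?R" by auto
  also have "prod g (?L \<union> ?R) = prod g ?L * prod g ?R"
  proof (rule prod.union_disjoint)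
    show "finite ?L" by (rule finite_subset[of _ "?I"]) auto
    show "finite ?R" by (rule finite_subset[of _ "?I"]) auto
  qed auto
  \<comment> \<open>The pair \<open>(j, i)\<close> with \<open>j \<le> i\<close> is matched with
    \<open>(Suc i, j)\<close>: both give the same element by \<open>coface_coface\<close>, and the
    extra \<open>Suc\<close> changes the parity, hence inverts the factor.\<close>
  also have "prod g ?R = (\<Prod>z \<in> ?L. inverse_of (g z))"
  proof (rule prod.reindex_bij_witness[of _ "\<lambda>(j, i). (i, j - 1)" "\<lambda>(j, i). (Suc i, j)"])
    fix z assume "z \<in> ?R"
    then obtain j i where z: "z = (j, i)" "j \<le> i" by auto
    have "inverse_of (inverse_of y) = y" if "y \<in> units_in (Suc (Suc n))" for y :: "'a galg"
      by (metis inverse_of_unique mult.commute that units_in_right_inverse)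
    then show "inverse_of (g (case z of (j, i) \<Rightarrow> (Suc i, j))) = g z"
      using u z by (auto simp: g_def sgn_pow_def coface_coface)
  qed auto
  also have "prod g ?L * \<dots> = (\<Prod>z \<in> ?L. g z * inverse_of (g z))"
    by (simp add: prod.distrib)
  also have "\<dots> = 1"
    by (rule prod.neutral)
      (auto simp: g_def intro!: units_in_right_inverse[of _ "Suc (Suc n)"] sgn_pow_units_in u)
  finally show ?thesis .
qed

section \<open>Logarithmic derivatives\<close>

text \<open>The derivation x_i d/dx_i; monomials are its eigenvectors, with the exponent as
  eigenvalue.\<close>

definition theta :: "nat \<Rightarrow> 'k::field galg \<Rightarrow> 'k galg" where
  "theta i = lin (\<lambda>m. Poly_Mapping.single m (m i))"

lemma theta_single [simp]:
  "theta i (Poly_Mapping.single m c) = Poly_Mapping.single m (c * m i)"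
  by (simp add: theta_def lin_single mult_single)

lemma theta_add: "theta i (f + g) = theta i f + theta i g"
  by (simp add: theta_def lin_add)

lemma theta_sum: "theta i (sum f I) = (\<Sum>j \<in> I. theta i (f j))"
  by (simp add: theta_def lin_sum)

lemma theta_zero [simp]: "theta i 0 = 0"
  by (simp add: theta_def)

lemma theta_uminus: "theta i (- f) = - theta i f"
  by (simp add: theta_def lin_uminus)

lemma theta_one [simp]: "theta i 1 = 0"
  using theta_single[of i 0 1] by simp

lemma lookup_theta: "Poly_Mapping.lookup (theta i f) m = m i * Poly_Mapping.lookup f m"
  by (induction f rule: galg_induct)
    (auto simp: lookup_single when_def theta_add lookup_add algebra_simps)

lemma theta_mult: "theta i (f * g) = theta i f * g + f * theta i g"
proof (induction f rule: galg_induct)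
  case (single m c)
  show ?case
  proof (induction g rule: galg_induct)
    case (single m' c')
    have "Poly_Mapping.single (m + m') (c * c' * (m i + m' i)) =
        Poly_Mapping.single (m + m') (c * m i * c') + Poly_Mapping.single (m + m') (c * (c' * m' i))"
      unfolding single_add[symmetric] by (simp add: algebra_simps)
    then show ?case by (simp add: mult_single)
  qed (simp add: theta_add distrib_left)
qed (simp add: theta_add distrib_right)

lemma theta_theta: "theta i (theta j f) = theta j (theta i f)"
  by (rule poly_mapping_eqI) (simp add: lookup_theta mult_ac)

lemma theta_supported: "f \<in> supported n \<Longrightarrow> theta i f \<in> supported n"
  by (simp add: supported_def in_keys_iff lookup_theta)

lemma theta_coface:
  "theta j (coface i f) =
    (if j < i then coface i (theta j f) else if j = 0 then 0 else coface i (theta (j - 1) f))"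
  by (induction f rule: galg_induct)
    (auto simp: coface_add theta_add coface_exp_def)

text \<open>This is df/f = dg up to a form with constant coefficients \<open>c i\<close>, with the
  denominator cleared. It is a relation because \<open>g\<close> is determined only up to a
  constant. The \<open>c i\<close> absorb the weight-zero part of df/f, which no
  \<open>theta i g\<close> can supply; in particular every monomial is related to 0.\<close>

definition dlog :: "'k::field galg \<Rightarrow> 'k galg \<Rightarrow> bool" where
  "dlog f g \<longleftrightarrow> (\<exists>c. \<forall>i. theta i f = (theta i g + const (c i)) * f)"

lemma dlog_one: "dlog 1 0"
  unfolding dlog_def by (rule exI[of _ "\<lambda>_. 0"]) simp

lemma dlog_mult:
  assumes "dlog f g" "dlog f' g'"
  shows "dlog (f * f') (g + g')"
proof -
  from assms obtain c c' where "\<And>i. theta i f = (theta i g + const (c i)) * f"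
    and "\<And>i. theta i f' = (theta i g' + const (c' i)) * f'"
    unfolding dlog_def by metis
  then show ?thesis unfolding dlog_def
    by (intro exI[of _ "\<lambda>i. c i + c' i"])
      (simp add: theta_mult theta_add single_add algebra_simps)
qed

lemma dlog_inverse:
  assumes "x * y = 1" "dlog x g"
  shows "dlog y (- g)"
proof -
  from assms obtain c where c: "\<And>i. theta i x = (theta i g + const (c i)) * x"
    unfolding dlog_def by metis
  have "theta i y = (theta i (- g) + const (- c i)) * y" for i
  proof -
    let ?a = "theta i g + const (c i)"
    have "0 = theta i (x * y)" by (simp add: assms)
    also have "\<dots> = ?a * (x * y) + x * theta i y" by (simp add: theta_mult c mult.assoc)
    finally have "x * theta i y = - ?a" by (simp add: assms add_eq_0_iff)
    then have "y * (x * theta i y) = y * (- ?a)" by simp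
    moreover have "y * (x * theta i y) = (x * y) * theta i y" by (simp only: mult_ac)
    ultimately show ?thesis by (simp add: assms theta_uminus single_uminus mult.commute)
  qed
  then show ?thesis unfolding dlog_def by (intro exI[of _ "\<lambda>i. - c i"]) blast
qed

lemma dlog_prod:
  "(\<And>i. i \<in> I \<Longrightarrow> dlog (f i) (g i)) \<Longrightarrow> dlog (prod f I) (sum g I)"
  by (induction I rule: infinite_finite_induct) (auto simp: dlog_one dlog_mult)

text \<open>By \<open>theta_coface\<close> each derivative of a coface is zero or the coface of a
  derivative, in the pattern of \<open>coface_exp\<close>. The constant form \<open>c\<close>
  therefore moves by the same rule as an exponent.\<close>

lemma dlog_coface:
  assumes "dlog f g"
  shows "dlog (coface i f) (coface i g)"
proof -
  from assms obtain c where c: "\<And>j. theta j f = (theta j g + const (c j)) * f"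
    unfolding dlog_def by metis
  have "coface_exp i c j = (if j < i then c j else if j = 0 then 0 else c (j - 1))" for j
    by (simp add: coface_exp_def)
  then show ?thesis unfolding dlog_def
    by (intro exI[of _ "coface_exp i c"]) (auto simp: theta_coface c coface_mult coface_add)
qed

text \<open>
  The logarithmic derivatives of \<open>f\<close> form a closed 1-form, and a closed 1-form on the torus is
  exact up to the constant forms: its component of weight \<open>m \<noteq> 0\<close> is integrated by dividing by any
  nonzero \<open>m i\<close>.
\<close>

lemma dlog_exists:
  assumes "f \<in> units_in n"
  obtains g where "g \<in> supported n" "Poly_Mapping.lookup g 0 = 0" "dlog f g"
proof -
  obtain y where f: "f \<in> supported n" and y: "y \<in> supported n" and fy: "f * y = 1"
    using assms by (auto simp: units_in_def)
  define a where "a = (\<lambda>i. theta i f * y)"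
  have a_supported: "a i \<in> supported n" for i
    using f y by (simp add: a_def supported_mult theta_supported)
  have a_zero: "a i = 0" if "i \<ge> n" for i
  proof -
    have "theta i f = 0"
      by (rule poly_mapping_eqI)
        (use f that in \<open>auto simp: lookup_theta supported_def in_keys_iff\<close>)
    then show ?thesis by (simp add: a_def)
  qed
  have theta_y: "theta i y = - (theta i f * y * y)" for i
  proof -
    have "theta i f * y + f * theta i y = 0"
      using theta_mult[of i f y] by (simp add: fy)
    then have "(theta i f * y + f * theta i y) * y = 0" by simp
    then have "theta i f * y * y + (f * y) * theta i y = 0" by (simp add: algebra_simps)
    then show ?thesis by (simp add: fy add_eq_0_iff)
  qed
  \<comment> \<open>By \<open>theta_y\<close>, one term contains the commuting second derivatives of
    \<open>f\<close> and the other is symmetric in \<open>i\<close> and \<open>j\<close>, so df/f is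
    closed.\<close>
  have "theta j (a i) = theta i (a j)" for i j
    by (simp add: a_def theta_mult theta_y theta_theta[of j i] mult_ac)
  then have closed: "m j * Poly_Mapping.lookup (a i) m = m i * Poly_Mapping.lookup (a j) m" for i j m
    by (metis lookup_theta)
  define \<iota> where "\<iota> = (\<lambda>m :: nat \<Rightarrow> 'a. LEAST i. m i \<noteq> 0)"
  have \<iota>: "m (\<iota> m) \<noteq> 0" if "m \<noteq> 0" for m
  proof -
    from that have "\<exists>i. m i \<noteq> 0" by (auto simp: fun_eq_iff)
    then show ?thesis unfolding \<iota>_def by (rule LeastI_ex)
  qed
  define b where "b = (\<lambda>m. if m = 0 then 0 else Poly_Mapping.lookup (a (\<iota> m)) m / m (\<iota> m))"
  \<comment> \<open>The value of \<open>b\<close> at 0 is the constant of integration, normalised to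
    zero. Since \<open>a i\<close> vanishes for \<open>i \<ge> n\<close>, finitely many supports
    cover \<open>b\<close>.\<close>
  define K where "K = (\<Union>i < n. Poly_Mapping.keys (a i))"
  define g where "g = (\<Sum>m \<in> K. Poly_Mapping.single m (b m))"
  have "finite K" by (simp add: K_def)
  have b: "b m = 0" if "m \<notin> K" for m
    using that a_zero[of "\<iota> m"] by (cases "\<iota> m < n") (auto simp: b_def K_def in_keys_iff)
  have g: "Poly_Mapping.lookup g m = b m" for m
    using \<open>finite K\<close> b[of m] by (auto simp: g_def lookup_sum lookup_single when_def)
  have "a i = theta i g + const (Poly_Mapping.lookup (a i) 0)" for i
  proof (rule poly_mapping_eqI)
    fix m
    show "Poly_Mapping.lookup (a i) m =
        Poly_Mapping.lookup (theta i g + const (Poly_Mapping.lookup (a i) 0)) m"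
      using closed[of m "\<iota> m" i] \<iota>[of m]
      by (auto simp: lookup_add lookup_theta g b_def lookup_single when_def field_simps)
  qed
  moreover have "theta i f = a i * f" for i
    using fy by (simp add: a_def mult.assoc mult.commute[of y])
  ultimately have "dlog f g"
    unfolding dlog_def by (intro exI[of _ "\<lambda>i. Poly_Mapping.lookup (a i) 0"]) simp
  moreover have "g \<in> supported n"
    unfolding g_def using a_supported
    by (intro supported_sum supported_single) (auto simp: K_def supported_def)
  moreover have "Poly_Mapping.lookup g 0 = 0" by (simp add: g b_def)
  ultimately show ?thesis by (intro that)
qed

text \<open>All \<open>theta i g\<close> are constant, while every nonzero exponent has some nonzero
  weight. Only the constant term of \<open>g\<close> escapes this, and the normalisation excludes
  it.\<close>

lemma dlog_one_imp_zero:
  assumes "dlog 1 g" "Poly_Mapping.lookup g 0 = 0"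
  shows "g = 0"
proof (rule poly_mapping_eqI)
  fix m
  from assms obtain c where c: "theta i g + const (c i) = 0" for i
    unfolding dlog_def by auto
  have "m i * Poly_Mapping.lookup g m + (c i when 0 = m) = 0" for i
    using arg_cong[OF c, of "\<lambda>h. Poly_Mapping.lookup h m" i]
    by (simp add: lookup_add lookup_theta lookup_single)
  then have eq: "m i * Poly_Mapping.lookup g m + (c i when 0 = m) = 0" for i .
  show "Poly_Mapping.lookup g m = Poly_Mapping.lookup 0 m"
  proof (cases "m = 0")
    case False
    then obtain i where "m i \<noteq> 0" by (auto simp: fun_eq_iff)
    then show ?thesis using eq[of i] False by auto
  qed (simp add: assms)
qed

text \<open>\<open>x\<close> is a joint eigenvector of all \<open>theta i\<close>. An exponent is
  the list of its weights, so the joint eigenspaces are lines spanned by monomials.\<close>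

lemma dlog_zero_imp_monomial:
  assumes "x \<in> units_in n" "dlog x 0"
  obtains m c where "x = Poly_Mapping.single m c" "c \<noteq> 0" "\<And>j. m j \<in> \<int>" "\<And>j. j \<ge> n \<Longrightarrow> m j = 0"
proof -
  from assms obtain c where c: "theta i x = const (c i) * x" for i
    unfolding dlog_def by auto
  have lookup_const_mult: "Poly_Mapping.lookup (const a * f) m = a * Poly_Mapping.lookup f m"
    for a m and f :: "'a galg"
    by (induction f rule: galg_induct)
      (auto simp: distrib_left lookup_add mult_single lookup_single when_def)
  have eq: "m = c" if "Poly_Mapping.lookup x m \<noteq> 0" for m
  proof
    fix i
    show "m i = c i"
      using arg_cong[OF c, of "\<lambda>h. Poly_Mapping.lookup h m" i] that
      by (simp add: lookup_theta lookup_const_mult)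
  qed
  have x: "x = Poly_Mapping.single c (Poly_Mapping.lookup x c)"
    by (rule poly_mapping_eqI) (use eq in \<open>auto simp: lookup_single when_def\<close>)
  have nz: "Poly_Mapping.lookup x c \<noteq> 0"
  proof
    assume "Poly_Mapping.lookup x c = 0"
    with x have "x = 0" by simp
    with assms(1) show False by (auto simp: units_in_def)
  qed
  show ?thesis
    by (rule that[OF x nz]) (use assms(1) nz in \<open>auto simp: units_in_def supported_def in_keys_iff\<close>)
qed

text \<open>
  The equation \<open>X u' = (t X + c) u\<close> on \<open>k[X]/(X\<^sup>p - 1)\<close> is a cyclic recursion for the coefficients of
  \<open>u\<close>, which is solvable if and only if \<open>\<Prod>i<p. (i - c) = t\<^sup>p\<close>. Its solution is a unit because the
  ideal generated by \<open>u\<close> is stable under \<open>X d/dX\<close>, hence contains the weight components of \<open>u\<close>.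
\<close>

lemma dlog_single_surj:
  fixes m :: "nat \<Rightarrow> 'k::alg_closed_field"
  assumes char: "CHAR('k) > 0" and m: "\<And>j. m j \<in> \<int>" "\<And>j. j \<ge> n \<Longrightarrow> m j = 0"
  obtains u where "u \<in> units_in n" "dlog u (Poly_Mapping.single m t)"
proof (cases "m = 0 \<or> t = 0")
  case True
  then have "dlog 1 (Poly_Mapping.single m t)"
    unfolding dlog_def by (intro exI[of _ "\<lambda>_. 0"]) auto
  then show ?thesis by (intro that[of 1]) auto
next
  case False
  then obtain l where l: "m l \<noteq> 0" and t: "t \<noteq> 0" by (auto simp: fun_eq_iff)
  obtain q where p: "CHAR('k) = Suc q" using char by (cases "CHAR('k)") auto
  \<comment> \<open>This is the Artin-Schreier equation \<open>c - c^p = t^p\<close>. The product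
    has degree \<open>p\<close> in \<open>c\<close>, so subtracting the constant leaves a
    nonconstant polynomial.\<close>
  obtain c where c: "(\<Prod>i < Suc q. of_nat i - c) = t ^ Suc q"
  proof -
    let ?P = "\<Prod>i < Suc q. [:of_nat i, - 1 :: 'k:]"
    have "degree ?P = (\<Sum>i < Suc q. degree [:of_nat i, - 1 :: 'k:])"
      by (rule degree_prod_eq_sum_degree) auto
    then have "degree (?P - [:t ^ Suc q:]) = Suc q"
      by (simp add: diff_conv_add_uminus degree_add_eq_left del: add_uminus_conv_diff prod.lessThan_Suc)
    then obtain x where "poly (?P - [:t ^ Suc q:]) x = 0"
      using alg_closed_imp_poly_has_root[of "?P - [:t ^ Suc q:]"] by auto
    then show ?thesis by (intro that[of x]) (simp add: poly_prod del: prod.lessThan_Suc)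
  qed
  \<comment> \<open>The recursion \<open>(j - c) * f j = t * f (j - 1)\<close> makes
    \<open>f j\<close> proportional to \<open>t^j\<close> over the product of \<open>i - c\<close>
    for \<open>1 \<le> i \<le> j\<close>; multiplying by the product over
    \<open>1 \<le> i < p\<close> clears the denominators.\<close>
  define f where "f j = t ^ j * (\<Prod>i \<in> {Suc j..<Suc q}. of_nat i - c)" for j
  define e where "e j = (\<lambda>i. of_nat j * m i)" for j
  define u where "u = (\<Sum>j < Suc q. Poly_Mapping.single (e j) (f j))"
  have e_Suc: "m + e j = e (Suc j)" for j by (auto simp: e_def fun_eq_iff algebra_simps)
  have e_0: "e 0 = 0" by (auto simp: e_def)
  have e_p: "e (Suc q) = 0" by (auto simp: e_def fun_eq_iff simp flip: p)
  have supp: "Poly_Mapping.single (e j) d \<in> supported n" for j d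
    by (rule supported_single) (use m in \<open>auto simp: e_def\<close>)
  have u_supp: "u \<in> supported n" unfolding u_def by (intro supported_sum supp)
  \<comment> \<open>This closes the cycle: the step after \<open>j = q\<close> lands on
    \<open>e (Suc q) = e 0\<close>, and \<open>t * f q\<close> is \<open>t ^ Suc q\<close>.\<close>
  have f_0: "(0 - c) * f 0 = t ^ Suc q"
  proof -
    have "{..<Suc q} = insert 0 {Suc 0..<Suc q}" by auto
    then show ?thesis unfolding c[symmetric] f_def by simp
  qed
  have f_Suc: "(of_nat (Suc j) - c) * f (Suc j) = t * f j" if "j < q" for j
  proof -
    have "(\<Prod>i \<in> {Suc j..<Suc q}. of_nat i - c) =
        (of_nat (Suc j) - c) * (\<Prod>i \<in> {Suc (Suc j)..<Suc q}. of_nat i - c)"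
      by (rule prod.atLeast_Suc_lessThan) (use that in simp)
    then show ?thesis by (simp only: f_def power_Suc mult_ac)
  qed
  have u_ode: "theta i u = (theta i (Poly_Mapping.single m t) + const (c * m i)) * u" for i
  proof -
    have "theta i u - const (c * m i) * u =
        (\<Sum>j < Suc q. Poly_Mapping.single (e j) ((of_nat j - c) * f j * m i))"
      unfolding u_def theta_sum sum_distrib_left sum_subtractf[symmetric]
      by (rule sum.cong) (auto simp: mult_single e_def algebra_simps simp flip: single_diff)
    also have "\<dots> = Poly_Mapping.single (e 0) ((0 - c) * f 0 * m i) +
        (\<Sum>j < q. Poly_Mapping.single (e (Suc j)) ((of_nat (Suc j) - c) * f (Suc j) * m i))"
      by (simp only: sum.lessThan_Suc_shift of_nat_0)
    also have "\<dots> = Poly_Mapping.single (e (Suc q)) (t * f q * m i) +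
        (\<Sum>j < q. Poly_Mapping.single (e (Suc j)) (t * f j * m i))"
      unfolding f_0 e_0 e_p by (intro arg_cong2[of _ _ _ _ "(+)"] sum.cong refl)
        (simp_all only: f_Suc lessThan_iff, simp add: f_def)
    also have "\<dots> = (\<Sum>j < Suc q. Poly_Mapping.single (e (Suc j)) (t * f j * m i))"
      by (simp add: add.commute)
    also have "\<dots> = theta i (Poly_Mapping.single m t) * u"
      unfolding u_def sum_distrib_left
      by (simp add: mult_single e_Suc mult_ac add.commute[of _ m] del: sum.lessThan_Suc)
    finally show ?thesis by (simp add: algebra_simps)
  qed
  \<comment> \<open>The operators \<open>theta l - (s + 1) * m l\<close> are applied to
    \<open>u\<close> for \<open>s < K\<close>. By \<open>u_ode\<close> each preserves the multiples
    of \<open>u\<close>, and it scales the component at \<open>e j\<close> by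
    \<open>(j - (s + 1)) * m l\<close>; after \<open>q\<close> of them only \<open>j = 0\<close> is
    left.\<close>
  have ideal: "\<exists>w \<in> supported n.
      (\<Sum>j < Suc q. Poly_Mapping.single (e j) (f j * (\<Prod>s < K. (of_nat j - of_nat (Suc s)) * m l))) = u * w"
    for K
  proof (induction K)
    case 0
    show ?case by (rule bexI[of _ 1]) (simp_all add: u_def)
  next
    case (Suc K)
    let ?F = "\<lambda>j. f j * (\<Prod>s < K. (of_nat j - of_nat (Suc s)) * m l)"
    from Suc obtain w where w: "w \<in> supported n"
        "(\<Sum>j < Suc q. Poly_Mapping.single (e j) (?F j)) = u * w"
      by blast
    let ?a = "theta l (Poly_Mapping.single m t) + const (c * m l)"
    let ?w = "?a * w + theta l w + const (- (of_nat (Suc K) * m l)) * w"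
    have "(\<Sum>j < Suc q. Poly_Mapping.single (e j) (f j * (\<Prod>s < Suc K. (of_nat j - of_nat (Suc s)) * m l))) =
        (\<Sum>j < Suc q. theta l (Poly_Mapping.single (e j) (?F j)) +
          const (- (of_nat (Suc K) * m l)) * Poly_Mapping.single (e j) (?F j))"
      by (rule sum.cong) (auto simp: mult_single e_def algebra_simps simp flip: single_add)
    also have "\<dots> = theta l (u * w) + const (- (of_nat (Suc K) * m l)) * (u * w)"
      unfolding sum.distrib theta_sum[symmetric] sum_distrib_left[symmetric] w ..
    also have "\<dots> = u * ?w"
      unfolding theta_mult u_ode by (simp only: algebra_simps)
    finally have "(\<Sum>j < Suc q. Poly_Mapping.single (e j)
        (f j * (\<Prod>s < Suc K. (of_nat j - of_nat (Suc s)) * m l))) = u * ?w" .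
    moreover have "Poly_Mapping.single m t \<in> supported n"
      by (rule supported_single) (use m in auto)
    then have "?w \<in> supported n"
      using w(1) by (intro supported_add supported_mult theta_supported supported_const)
    ultimately show ?case by blast
  qed
  define d where "d = f 0 * (\<Prod>s < q. (0 - of_nat (Suc s)) * m l)"
  have "(\<Sum>j < Suc q. Poly_Mapping.single (e j) (f j * (\<Prod>s < q. (of_nat j - of_nat (Suc s)) * m l))) = const d"
  proof -
    have "(\<Prod>s < q. (of_nat (Suc i) - of_nat (Suc s)) * m l) = 0" if "i < q" for i
      by (rule prod_zero) (use that in auto)
    then have "(\<Sum>i < q. Poly_Mapping.single (e (Suc i))
        (f (Suc i) * (\<Prod>s < q. (of_nat (Suc i) - of_nat (Suc s)) * m l))) = 0"
      by (intro sum.neutral ballI) (simp only: lessThan_iff mult_zero_right single_zero)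
    then show ?thesis
      by (simp only: sum.lessThan_Suc_shift e_0 d_def of_nat_0 add_0_right)
  qed
  with ideal[of q] obtain w where w: "w \<in> supported n" "u * w = const d" by metis
  \<comment> \<open>The numbers from 1 to \<open>p - 1\<close> are nonzero in \<open>k\<close>, and
    so is \<open>f 0\<close>, hence the surviving constant \<open>d\<close> is invertible.\<close>
  have "of_nat (Suc s) \<noteq> (0 :: 'k)" if "s < q" for s
    unfolding of_nat_eq_0_iff_char_dvd p using that by (auto dest: dvd_imp_le)
  moreover have "f 0 \<noteq> 0" using f_0 t by (metis mult_zero_right power_not_zero)
  ultimately have "d \<noteq> 0" using l by (simp add: d_def del: of_nat_Suc)
  have "u \<in> units_in n"
  proof (rule units_inI[OF u_supp])
    show "w * const (1 / d) \<in> supported n" using w by (intro supported_mult) auto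
    have "u * (w * const (1 / d)) = const d * const (1 / d)" by (simp only: w mult.assoc[symmetric])
    then show "u * (w * const (1 / d)) = 1" using \<open>d \<noteq> 0\<close> by (simp add: mult_single)
  qed
  moreover have "dlog u (Poly_Mapping.single m t)"
    unfolding dlog_def by (intro exI[of _ "\<lambda>i. c * m i"] allI u_ode)
  ultimately show ?thesis by (rule that)
qed

text \<open>Products of units have the sum of their potentials, so each monomial of \<open>h\<close>
  can be treated separately.\<close>

lemma dlog_surj:
  fixes h :: "'k::alg_closed_field galg"
  assumes char: "CHAR('k) > 0" and h: "h \<in> supported n"
  obtains u where "u \<in> units_in n" "dlog u h"
proof -
  have "\<exists>u \<in> units_in n. dlog u (Poly_Mapping.single m (Poly_Mapping.lookup h m))"
    if "m \<in> Poly_Mapping.keys h" for m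
    using dlog_single_surj[OF char, of m n] h that by (metis (mono_tags, lifting) mem_Collect_eq supported_def)
  then obtain U where U: "\<And>m. m \<in> Poly_Mapping.keys h \<Longrightarrow> U m \<in> units_in n"
      "\<And>m. m \<in> Poly_Mapping.keys h \<Longrightarrow> dlog (U m) (Poly_Mapping.single m (Poly_Mapping.lookup h m))"
    by metis
  have "dlog (prod U (Poly_Mapping.keys h)) h"
    using dlog_prod[of "Poly_Mapping.keys h" U "\<lambda>m. Poly_Mapping.single m (Poly_Mapping.lookup h m)"] U(2)
    by (simp add: sum_single_lookup)
  then show ?thesis using U(1) by (intro that) (rule units_in_prod)
qed

section \<open>The additive complex and its contraction\<close>

definition contraction :: "'k::field galg \<Rightarrow> 'k galg" where
  "contraction = lin (\<lambda>m. if m 0 = 0 then grouplike (\<lambda>j. m (Suc j)) else 0)"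

definition additive_differential :: "nat \<Rightarrow> 'k::field galg \<Rightarrow> 'k galg" where
  "additive_differential n f = (\<Sum>i \<le> Suc n. if even i then coface i f else - coface i f)"

lemma contraction_single:
  "contraction (Poly_Mapping.single m c) =
    (if m 0 = 0 then Poly_Mapping.single (\<lambda>j. m (Suc j)) c else 0)"
  by (simp add: contraction_def lin_single mult_single)

lemma contraction_add: "contraction (f + g) = contraction f + contraction g"
  by (simp add: contraction_def lin_add)

lemma contraction_coface_0: "contraction (coface 0 f) = f"
  by (induction f rule: galg_induct)
    (simp_all add: coface_add contraction_add contraction_single coface_exp_def)

text \<open>Together with \<open>contraction_coface_0\<close> this makes \<open>contraction\<close>
  an extra codegeneracy. For \<open>i = 0\<close>, \<open>coface 1\<close> doubles the leading
  exponent; on the part of weight zero one copy is dropped and the other is the zero that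
  \<open>coface 0\<close> inserts.\<close>

lemma contraction_coface_Suc: "contraction (coface (Suc i) f) = coface i (contraction f)"
proof (induction f rule: galg_induct)
  case (single m c)
  have "(\<lambda>j. coface_exp (Suc i) m (Suc j)) = coface_exp i (\<lambda>j. m (Suc j))" if "m 0 = 0"
    using that by (auto simp: coface_exp_def fun_eq_iff)
  moreover have "coface_exp (Suc i) m 0 = m 0" by (simp add: coface_exp_def)
  ultimately show ?case
    using coface_single[of i 0 0] by (auto simp: contraction_single simp del: single_one)
qed (simp add: coface_add contraction_add)

text \<open>The homotopy identity \<open>h d = 1 - d h\<close>: coface 0 contributes
  \<open>f\<close>, and shifting the index of the others by one flips their signs.\<close>

lemma contraction_additive_differential:
  "contraction (additive_differential (Suc k) f) = f - additive_differential k (contraction f)"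
proof -
  have neg: "contraction (- g) = - contraction g" for g :: "'a galg"
    by (simp add: contraction_def lin_uminus)
  have "contraction (additive_differential (Suc k) f) =
      (\<Sum>i \<le> Suc (Suc k). contraction (if even i then coface i f else - coface i f))"
    unfolding additive_differential_def contraction_def by (rule lin_sum)
  also have "\<dots> = f + (\<Sum>i \<le> Suc k. - (if even i then coface i (contraction f) else - coface i (contraction f)))"
    unfolding sum.atMost_Suc_shift[of _ "Suc k"]
    by (intro arg_cong2[of _ _ _ _ "(+)"] sum.cong) (auto simp: neg contraction_coface_0 contraction_coface_Suc)
  finally show ?thesis by (simp add: additive_differential_def sum_negf del: sum.atMost_Suc)
qed

lemma contraction_supported: "f \<in> supported (Suc n) \<Longrightarrow> contraction f \<in> supported n"
  unfolding contraction_def by (rule supported_lin) (auto simp: supported_def)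

text \<open>Cofaces respect \<open>dlog\<close>, inverses become negatives and products become sums,
  so the two alternating differentials correspond.\<close>

lemma dlog_differential:
  assumes "x \<in> units_in n" "dlog x g"
  shows "dlog (differential n x) (additive_differential n g)"
  unfolding differential_def additive_differential_def
proof (rule dlog_prod)
  fix i
  have "coface i x * inverse_of (coface i x) = 1"
    using coface_units_in[OF assms(1)] by (rule units_in_right_inverse)
  then show "dlog (sgn_pow i (coface i x)) (if even i then coface i g else - coface i g)"
    using dlog_coface[OF assms(2), of i] by (auto simp: sgn_pow_def intro: dlog_inverse)
qed

section \<open>Acyclicity\<close>

definition exp_differential :: "nat \<Rightarrow> (nat \<Rightarrow> 'k) \<Rightarrow> nat \<Rightarrow> 'k::field" where
  "exp_differential n m = (\<Sum>i \<le> Suc n. if even i then coface_exp i m else - coface_exp i m)"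

definition axis :: "'k \<Rightarrow> nat \<Rightarrow> 'k::field" where
  "axis a = (\<lambda>j. if j = 0 then a else 0)"

lemma prod_single:
  fixes e :: "'i \<Rightarrow> nat \<Rightarrow> 'k::field" and a :: "'i \<Rightarrow> 'k"
  assumes "finite I"
  shows "(\<Prod>i \<in> I. Poly_Mapping.single (e i) (a i)) =
    Poly_Mapping.single (\<Sum>i \<in> I. e i) (\<Prod>i \<in> I. a i)"
  using assms
proof (induction I rule: finite_induct)
  case empty
  show ?case unfolding prod.empty sum.empty single_one ..
next
  case (insert i I)
  show ?case
    unfolding prod.insert[OF insert.hyps] sum.insert[OF insert.hyps] insert.IH mult_single ..
qed

text \<open>All \<open>n + 2\<close> cofaces fix the scalar, so its alternating product is
  \<open>c\<close> or 1 according to parity.\<close>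

lemma differential_single:
  assumes "c \<noteq> 0"
  shows "differential n (Poly_Mapping.single m c) =
    Poly_Mapping.single (exp_differential n m) (if odd n then c else 1)"
proof -
  have "(\<Prod>i \<le> Suc n. if even i then c else 1 / c) = (if odd n then c else 1)"
    using assms by (induction n) auto
  moreover have "differential n (Poly_Mapping.single m c) =
      (\<Prod>i \<le> Suc n. Poly_Mapping.single (if even i then coface_exp i m else - coface_exp i m)
        (if even i then c else 1 / c))"
    unfolding differential_def
    by (rule prod.cong) (auto simp: sgn_pow_def inverse_of_single assms)
  ultimately show ?thesis
    by (simp only: prod_single[OF finite_atMost] exp_differential_def)
qed

lemma exp_differential_zero [simp]: "exp_differential n 0 = 0"
  unfolding exp_differential_def by (rule sum.neutral) auto

text \<open>Coface 1 doubles the entry that coface 0 moves, so these two contribute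
  \<open>- axis a\<close>; the other \<open>k + 1\<close> cofaces fix \<open>axis a\<close> and
  alternate.\<close>

lemma exp_differential_axis:
  "exp_differential (Suc k) (axis a) = (if odd k then - axis a else 0)"
proof -
  have "(\<Sum>i \<le> k. if even i then v else - v) = (if even k then v else 0)" for v :: "nat \<Rightarrow> 'a"
    by (induction k) auto
  moreover have "coface_exp (Suc (Suc i)) (axis a) = axis a" for i
    by (auto simp: coface_exp_def axis_def)
  moreover have "coface_exp 0 (axis a) = coface_exp (Suc 0) (axis a) - axis a"
    by (auto simp: coface_exp_def axis_def fun_eq_iff)
  ultimately show ?thesis
    unfolding exp_differential_def sum.atMost_Suc_shift[of _ "Suc k"] sum.atMost_Suc_shift[of _ k]
    by (simp cong: if_cong)
qed

text \<open>After the first coordinate is dropped, cofaces 0 and 1 of \<open>m\<close> agree and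
  cancel. What remains of the cocycle equation is the part of \<open>exp_differential k\<close>
  beyond coface 0. Hence \<open>m\<close> is a coboundary up to its first coordinate.\<close>

lemma exp_differential_shift:
  assumes "exp_differential (Suc k) m = 0"
  shows "exp_differential k (\<lambda>j. m (Suc j)) = coface_exp 0 (\<lambda>j. m (Suc j))"
proof -
  define shift where "shift = (\<lambda>m :: nat \<Rightarrow> 'a. \<lambda>j. m (Suc j))"
  have shift_sum: "shift (sum f I) = (\<Sum>i \<in> I. shift (f i))" for f and I :: "nat set"
    by (induction I rule: infinite_finite_induct) (auto simp: shift_def fun_eq_iff)
  have shift_add: "shift (m + m') = shift m + shift m'" for m m'
    by (auto simp: shift_def)
  have shift: "shift (- m) = - shift m" "shift 0 = 0" "shift (coface_exp 0 m) = m"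
    "shift (coface_exp (Suc 0) m) = m"
    "shift (coface_exp (Suc (Suc i)) m) = coface_exp (Suc i) (shift m)" for m i
    by (auto simp: shift_def coface_exp_def fun_eq_iff)
  let ?S = "\<Sum>i \<le> k. if even i then coface_exp (Suc i) (shift m) else - coface_exp (Suc i) (shift m)"
  have "0 = shift (exp_differential (Suc k) m)" using assms shift by simp
  also have "\<dots> = ?S"
    unfolding exp_differential_def sum.atMost_Suc_shift[of _ "Suc k"] sum.atMost_Suc_shift[of _ k]
    by (simp add: shift shift_add shift_sum diff_conv_add_uminus del: add_uminus_conv_diff add: if_distrib[of shift] cong: if_cong)
  finally have "?S = 0" by simp
  moreover have "exp_differential k (shift m) = coface_exp 0 (shift m) - ?S"
    unfolding exp_differential_def sum.atMost_Suc_shift[of _ k] diff_conv_add_uminus sum_negf[symmetric]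
    by (auto intro!: sum.cong)
  ultimately show ?thesis by (simp add: shift_def)
qed

text \<open>Modulo coboundaries, the contraction and \<open>dlog_surj\<close> remove the potential,
  leaving a monomial; \<open>exp_differential_shift\<close> removes all of its exponents but the
  first. Parity then forces either the scalar or that exponent to be trivial.\<close>

lemma cocycle_reduction:
  fixes x :: "'k::alg_closed_field galg"
  assumes char: "CHAR('k) > 0"
    and x: "x \<in> units_in (Suc k)" and cocycle: "differential (Suc k) x = 1"
  obtains u a c where "u \<in> units_in k" "a \<in> \<int>" "c \<noteq> 0"
    "x = differential k u * Poly_Mapping.single (axis a) c"
    "even k \<Longrightarrow> c = 1" "odd k \<Longrightarrow> a = 0"
proof -
  obtain g where g: "g \<in> supported (Suc k)" "Poly_Mapping.lookup g 0 = 0" "dlog x g"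
    using dlog_exists[OF x] .
  have "additive_differential (Suc k) g = 0"
  proof (rule dlog_one_imp_zero)
    show "dlog 1 (additive_differential (Suc k) g)"
      using dlog_differential[OF x g(3)] cocycle by simp
    \<comment> \<open>A coface sends only the zero exponent to zero, so it preserves the constant
      coefficient, and the normalisation of \<open>g\<close> passes to its differential.\<close>
    have "Poly_Mapping.lookup (coface i g) 0 = 0" for i
    proof -
      have "coface_exp i m = 0 \<longleftrightarrow> m = 0" for m :: "nat \<Rightarrow> 'k"
      proof
        assume *: "coface_exp i m = 0"
        have "m j = 0" for j
          using fun_cong[OF *, of j] fun_cong[OF *, of "Suc j"]
          by (cases "j < i") (auto simp: coface_exp_def)
        then show "m = 0" by auto
      qed simp
      then have "Poly_Mapping.lookup (coface i f) 0 = Poly_Mapping.lookup f 0" for f :: "'k galg"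
        by (induction f rule: galg_induct) (auto simp: coface_add lookup_add lookup_single)
      then show ?thesis using g(2) by simp
    qed
    then show "Poly_Mapping.lookup (additive_differential (Suc k) g) 0 = 0"
      unfolding additive_differential_def lookup_sum by (intro sum.neutral) auto
  qed
  then have dg: "g = additive_differential k (contraction g)"
    using contraction_additive_differential[of k g] by (simp add: contraction_def)
  obtain u where u: "u \<in> units_in k" "dlog u (contraction g)"
    using dlog_surj[OF char contraction_supported[OF g(1)]] .
  define y where "y = differential k u"
  have y: "y \<in> units_in (Suc k)" "y * inverse_of y = 1" "differential (Suc k) y = 1"
    using differential_units_in[OF u(1)] differential_differential[OF u(1)]
    by (auto simp: y_def units_in_right_inverse)
  have "dlog (inverse_of y) (- g)"
    using dlog_inverse[OF y(2)] dlog_differential[OF u] dg by (simp add: y_def)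
  from dlog_mult[OF g(3) this] have "dlog (x * inverse_of y) 0" by simp
  moreover have z_unit: "x * inverse_of y \<in> units_in (Suc k)"
    using x y(1) by (intro units_in_mult units_in_inverse)
  ultimately obtain m c where z: "x * inverse_of y = Poly_Mapping.single m c" "c \<noteq> 0"
      "\<And>j. m j \<in> \<int>" "\<And>j. j \<ge> Suc k \<Longrightarrow> m j = 0"
    using dlog_zero_imp_monomial by blast
  have x_eq: "x = y * Poly_Mapping.single m c"
    unfolding z(1)[symmetric] mult.left_commute[of y] y(2) by simp
  have "differential (Suc k) (Poly_Mapping.single m c) = 1"
    using cocycle differential_mult[OF y(1) z_unit] by (simp add: x_eq[symmetric] z(1) y(3))
  \<comment> \<open>For even \<open>k\<close> the scalar survives in the differential, so this one
    comparison of monomials gives both \<open>dm\<close> and \<open>c = 1\<close>.\<close>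
  then have "Poly_Mapping.single (exp_differential (Suc k) m) (if even k then c else 1) = grouplike 0"
    by (simp add: differential_single[OF z(2)])
  from arg_cong[OF this, of "\<lambda>f. Poly_Mapping.lookup f (exp_differential (Suc k) m)"]
  have dm: "exp_differential (Suc k) m = 0" and c: "even k \<Longrightarrow> c = 1"
    using z(2) by (auto simp: lookup_single when_def simp del: single_one split: if_splits)
  define s where "s = (\<lambda>j. m (Suc j))"
  have m_eq: "m = coface_exp 0 s + axis (m 0)"
    by (auto simp: s_def coface_exp_def axis_def fun_eq_iff)
  have s_unit: "grouplike s \<in> units_in k"
    by (rule units_in_single) (use z in \<open>auto simp: s_def\<close>)
  have "differential k (grouplike s) = grouplike (coface_exp 0 s)"
    using exp_differential_shift[OF dm] by (simp add: differential_single s_def)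
  then have "x = differential k (u * grouplike s) * Poly_Mapping.single (axis (m 0)) c"
    using differential_mult[OF u(1) s_unit]
    by (simp add: x_eq y_def mult.assoc mult_single flip: m_eq)
  \<comment> \<open>The factor left beside the coboundary is itself a cocycle, and for odd
    \<open>k\<close> its differential has exponent \<open>- axis (m 0)\<close>.\<close>
  moreover have "m 0 = 0" if "odd k"
  proof -
    have "differential (Suc k) (Poly_Mapping.single (axis (m 0)) c) = 1"
    proof -
      have su: "Poly_Mapping.single (axis (m 0)) c \<in> units_in (Suc k)"
        by (rule units_in_single) (use z in \<open>auto simp: axis_def\<close>)
      have "differential k (u * grouplike s) \<in> units_in (Suc k)"
        using u(1) s_unit by (intro differential_units_in units_in_mult)
      from differential_mult[OF this su] show ?thesis
        using cocycle differential_differential[OF units_in_mult[OF u(1) s_unit]]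
        by (simp flip: calculation)
    qed
    then have "Poly_Mapping.single (- axis (m 0)) 1 = (grouplike 0 :: 'k galg)"
      using that by (simp add: differential_single[OF z(2)] exp_differential_axis)
    from arg_cong[OF this, of "\<lambda>f. Poly_Mapping.lookup f (- axis (m 0))"]
    have "- axis (m 0) = 0"
      by (auto simp: lookup_single when_def simp del: single_one split: if_splits)
    then have "(- axis (m 0)) 0 = 0" by (simp only: zero_fun_apply)
    then show ?thesis by (simp add: axis_def)
  qed
  ultimately show ?thesis
    using u(1) s_unit z c by (intro that[of "u * grouplike s" "m 0" c]) (auto simp: units_in_mult)
qed

text \<open>The remaining factor \<open>c x_0^a\<close> is the differential of
  \<open>const c\<close> for odd \<open>k\<close> and of \<open>x_0^(-a)\<close> for even
  \<open>k\<close>. The latter lies in degree \<open>k\<close> because \<open>k > 0\<close>.\<close>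

lemma differential_exact:
  fixes x :: "'k::alg_closed_field galg"
  assumes "CHAR('k) > 0" and k: "k > 0"
    and "x \<in> units_in (Suc k)" and "differential (Suc k) x = 1"
  obtains u where "u \<in> units_in k" "differential k u = x"
proof -
  obtain u a c where u: "u \<in> units_in k" "a \<in> \<int>" "c \<noteq> 0"
      "x = differential k u * Poly_Mapping.single (axis a) c"
      "even k \<Longrightarrow> c = 1" "odd k \<Longrightarrow> a = 0"
    using cocycle_reduction[OF assms(1,3,4)] by blast
  obtain k' where k': "k = Suc k'" using k by (cases k) auto
  define v where "v = (if odd k then const c else grouplike (axis (- a)))"
  have "axis 0 = (0 :: nat \<Rightarrow> 'k)" "- axis (- a) = axis a" by (auto simp: axis_def)
  then have "differential k v = Poly_Mapping.single (axis a) c"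
    using u(3,5,6) k' by (auto simp: v_def differential_single exp_differential_axis)
  moreover have "v \<in> units_in k"
    unfolding v_def using u(2,3) k by (auto intro!: units_in_single simp: axis_def)
  ultimately show ?thesis
    using u(1,4) by (intro that[of "u * v"]) (auto simp: units_in_mult differential_mult)
qed

lemma differential_0:
  assumes "u \<in> units_in 0"
  shows "differential 0 u = 1"
proof -
  define c where "c = Poly_Mapping.lookup u 0"
  have u: "u = const c"
  proof (rule poly_mapping_eqI)
    fix m
    have "m = 0" if "m \<in> Poly_Mapping.keys u"
      using assms that by (auto simp: units_in_def supported_def fun_eq_iff)
    then show "Poly_Mapping.lookup u m = Poly_Mapping.lookup (const c) m"
      by (auto simp: c_def lookup_single when_def in_keys_iff)
  qed
  have "c \<noteq> 0" using assms u by (auto simp: units_in_def)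
  then show ?thesis by (simp add: u differential_single)
qed

text \<open>In \<open>cocycle_reduction\<close> with \<open>k = 0\<close> parity forces
  \<open>c = 1\<close>, and differentials from degree 0 are trivial, so the exponent is the whole
  cocycle.\<close>

lemma cocycles_1:
  fixes x :: "'k::alg_closed_field galg"
  assumes "CHAR('k) > 0"
  shows "x \<in> units_in 1 \<and> differential 1 x = 1 \<longleftrightarrow> (\<exists>a \<in> \<int>. x = grouplike (axis a))"
proof
  assume "x \<in> units_in 1 \<and> differential 1 x = 1"
  then obtain u a c where "u \<in> units_in 0" "a \<in> \<int>"
      "x = differential 0 u * Poly_Mapping.single (axis a) c" "c = 1"
    using cocycle_reduction[OF assms, of x 0] by auto
  then show "\<exists>a \<in> \<int>. x = grouplike (axis a)" by (auto simp: differential_0)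
next
  assume "\<exists>a \<in> \<int>. x = grouplike (axis a)"
  then obtain a where a: "a \<in> \<int>" "x = grouplike (axis a)" by blast
  have "x \<in> units_in 1"
    unfolding a(2) using a(1) by (intro units_in_single) (auto simp: axis_def)
  then show "x \<in> units_in 1 \<and> differential 1 x = 1"
    by (simp add: a(2) differential_single exp_differential_axis)
qed

section \<open>Convolution algebras of the function Hopf algebra\<close>

text \<open>The functional given by a point of G^n. These are the group elements once the dual of
  the function algebra is read as the group algebra.\<close>

definition eval_at :: "'a list \<Rightarrow> ('a \<Rightarrow> 'k::field) list \<Rightarrow> 'k" where
  "eval_at v bs = (\<Prod>(a, b) \<leftarrow> zip v bs. b a)"

lemma eval_at_simps [simp]:
  "eval_at [] bs = 1" "eval_at (a # v) (b # bs) = b a * eval_at v bs"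
  by (simp_all add: eval_at_def)

lemma eval_at_append:
  "length v = length bs \<Longrightarrow> eval_at (v @ w) (bs @ cs) = eval_at v bs * eval_at w cs"
  by (simp add: eval_at_def)

lemma eval_at_update:
  assumes "length v = length bs" "i < length bs"
  shows "eval_at v (bs[i := b]) = b (v ! i) * (eval_at (take i v) (take i bs) * eval_at (drop (Suc i) v) (drop (Suc i) bs))"
proof -
  have "eval_at v (bs[i := b]) =
      eval_at (take i v @ v ! i # drop (Suc i) v) (take i bs @ b # drop (Suc i) bs)"
    using assms by (simp add: upd_conv_take_nth_drop id_take_nth_drop[symmetric])
  then show ?thesis using assms by (simp add: eval_at_append)
qed

lemma sum_set_Cons: "sum F (set_Cons A L) = (\<Sum>x \<in> A. \<Sum>xs \<in> L. F (x # xs))"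
proof -
  have "set_Cons A L = (\<lambda>(x, xs). x # xs) ` (A \<times> L)" by (auto simp: set_Cons_def)
  moreover have "inj_on (\<lambda>(x, xs). x # xs) (A \<times> L)" by (auto simp: inj_on_def)
  ultimately show ?thesis by (simp add: sum.reindex sum.cartesian_product comp_def prod.case_distrib)
qed

locale cyclic_functions =
  fixes p :: nat and B :: "('k::field, int \<Rightarrow> 'k) hopf_algebra"
  assumes char: "CHAR('k) = p" and p_pos: "p > 0"
    and B_eq: "B = fun_hopf_algebra (integer_mod_group p)"
begin

abbreviation delta :: "int \<Rightarrow> int \<Rightarrow> 'k" where
  "delta \<equiv> delta_fun (integer_mod_group p)"

definition words :: "nat \<Rightarrow> int list set" where
  "words n = {v. length v = n \<and> set v \<subseteq> {0..<int p}}"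

definition exponent :: "int list \<Rightarrow> nat \<Rightarrow> 'k" where
  "exponent v = (\<lambda>j. if j < length v then of_int (v ! j) else 0)"

text \<open>The tuple of delta functions at \<open>v\<close> is dual to evaluation at
  \<open>v\<close>, and that evaluation corresponds to the monomial with exponent
  \<open>exponent v\<close>.\<close>

definition symbol :: "nat \<Rightarrow> ((int \<Rightarrow> 'k) list \<Rightarrow> 'k) \<Rightarrow> 'k galg" where
  "symbol n T = (\<Sum>v \<in> words n. Poly_Mapping.single (exponent v) (T (map delta v)))"

text \<open>The index set is free and \<open>e\<close> may repeat words, so a convolution product,
  indexed by pairs of words, has this form before equal words are collected.\<close>

definition eval_form :: "nat \<Rightarrow> 'i set \<Rightarrow> ('i \<Rightarrow> int list) \<Rightarrow> ('i \<Rightarrow> 'k) \<Rightarrow> (int \<Rightarrow> 'k) list \<Rightarrow> 'k" where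
  "eval_form n I e c = (\<lambda>bs \<in> tuples B n. \<Sum>i \<in> I. c i * eval_at (e i) bs)"

lemma carrier_group: "carrier (integer_mod_group p) = {0..<int p}"
  using p_pos by (simp add: carrier_integer_mod_group)

lemma carrier_B: "carrier B = {0..<int p} \<rightarrow>\<^sub>E UNIV"
  by (simp add: B_eq carrier_group)

lemma delta_closed: "delta a \<in> carrier B"
  by (simp add: carrier_B delta_fun_def carrier_group)

lemma delta_apply: "x \<in> {0..<int p} \<Longrightarrow> delta a x = (if x = a then 1 else 0)"
  by (simp add: delta_fun_def carrier_group)

lemma finite_words: "finite (words n)"
  unfolding words_def using finite_lists_length_eq[of "{0..<int p}" n] by (simp add: conj_commute)

lemma map_delta_tuples: "length v = n \<Longrightarrow> map delta v \<in> tuples B n"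
  using delta_closed by (auto simp: tuples_def)

lemma words_Cons [simp]: "a # v \<in> words (Suc n) \<longleftrightarrow> a \<in> {0..<int p} \<and> v \<in> words n"
  by (auto simp: words_def)

lemma words_nth: "v \<in> words n \<Longrightarrow> i < n \<Longrightarrow> v ! i \<in> {0..<int p}"
  using nth_mem[of i v] unfolding words_def by blast

lemma words_length: "v \<in> words n \<Longrightarrow> length v = n"
  by (simp add: words_def)

section \<open>Multilinear forms as elements of the group algebra\<close>

lemma eval_form_closed:
  assumes "\<And>i. i \<in> I \<Longrightarrow> e i \<in> words n"
  shows "eval_form n I e c \<in> multilinear_forms B n"
proof -
  have "eval_form n I e c (bs[j := (d \<odot>\<^bsub>B\<^esub> x) \<oplus>\<^bsub>B\<^esub> y]) =
      d * eval_form n I e c (bs[j := x]) + eval_form n I e c (bs[j := y])"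
    if bs: "bs \<in> tuples B n" and j: "j < n" and xy: "x \<in> carrier B" "y \<in> carrier B" for bs j x y d
  proof -
    have z: "(d \<odot>\<^bsub>B\<^esub> x) \<oplus>\<^bsub>B\<^esub> y \<in> carrier B"
      using xy by (simp add: B_eq)
    have upd: "bs[j := b] \<in> tuples B n" if "b \<in> carrier B" for b
      using bs that set_update_subset_insert[of bs j b] by (auto simp: tuples_def)
    have "eval_at (e i) (bs[j := (d \<odot>\<^bsub>B\<^esub> x) \<oplus>\<^bsub>B\<^esub> y]) =
        d * eval_at (e i) (bs[j := x]) + eval_at (e i) (bs[j := y])" if "i \<in> I" for i
    proof -
      have "length (e i) = length bs" "j < length bs" "e i ! j \<in> {0..<int p}"
        using words_length[OF assms[OF that]] words_nth[OF assms[OF that] j] bs j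
        by (simp_all add: tuples_def)
      then show ?thesis by (simp add: eval_at_update B_eq carrier_group algebra_simps)
    qed
    then show ?thesis
      by (simp add: eval_form_def upd xy z sum_distrib_left sum.distrib[symmetric] algebra_simps
        cong: sum.cong)
  qed
  then show ?thesis by (auto simp: multilinear_forms_def eval_form_def)
qed

lemma eval_at_delta:
  "v \<in> words n \<Longrightarrow> w \<in> words n \<Longrightarrow> eval_at v (map delta w) = (if v = w then 1 else 0)"
proof (induction n arbitrary: v w)
  case (Suc n)
  then obtain a v' b w' where "v = a # v'" "w = b # w'"
    by (metis words_length length_Suc_conv)
  with Suc show ?case by (auto simp: delta_apply)
qed (simp add: words_def)

lemma symbol_eval_form:
  assumes e: "\<And>i. i \<in> I \<Longrightarrow> e i \<in> words n" and I: "finite I"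
  shows "symbol n (eval_form n I e c) = (\<Sum>i \<in> I. Poly_Mapping.single (exponent (e i)) (c i))"
proof -
  have single_sum: "Poly_Mapping.single m (\<Sum>i \<in> I. f i) = (\<Sum>i \<in> I. Poly_Mapping.single m (f i))"
    for m :: "nat \<Rightarrow> 'k" and f :: "'a \<Rightarrow> 'k"
    by (induction I rule: infinite_finite_induct) (simp_all add: single_add)
  have "symbol n (eval_form n I e c) = (\<Sum>v \<in> words n. Poly_Mapping.single (exponent v)
      (\<Sum>i \<in> I. if v = e i then c i else 0))"
    unfolding symbol_def
  proof (rule sum.cong[OF refl])
    fix v assume v: "v \<in> words n"
    have "eval_form n I e c (map delta v) = (\<Sum>i \<in> I. c i * eval_at (e i) (map delta v))"
      using map_delta_tuples[OF words_length[OF v]] by (simp add: eval_form_def)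
    also have "\<dots> = (\<Sum>i \<in> I. if v = e i then c i else 0)"
      by (rule sum.cong) (auto simp: eval_at_delta[OF e v])
    finally show "Poly_Mapping.single (exponent v) (eval_form n I e c (map delta v)) =
        Poly_Mapping.single (exponent v) (\<Sum>i \<in> I. if v = e i then c i else 0)" by simp
  qed
  also have "\<dots> = (\<Sum>i \<in> I. \<Sum>v \<in> words n. Poly_Mapping.single (exponent v) (if v = e i then c i else 0))"
    unfolding single_sum by (rule sum.swap)
  also have "\<dots> = (\<Sum>i \<in> I. \<Sum>v \<in> words n. if v = e i then Poly_Mapping.single (exponent v) (c i) else 0)"
    by (intro sum.cong refl) simp
  also have "\<dots> = (\<Sum>i \<in> I. Poly_Mapping.single (exponent (e i)) (c i))"
    by (rule sum.cong) (simp_all add: finite_words e)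
  finally show ?thesis .
qed

lemma forms_eqI:
  assumes T: "T \<in> multilinear_forms B n" and T': "T' \<in> multilinear_forms B n"
    and eq: "\<And>v. v \<in> words n \<Longrightarrow> T (map delta v) = T' (map delta v)"
  shows "T = T'"
proof -
  have slot: "F bs = (\<Sum>g \<in> {0..<int p}. (bs ! i) g * F (bs[i := delta g]))"
    if F: "F \<in> multilinear_forms B n" and bs: "bs \<in> tuples B n" and i: "i < n" for F bs i
  proof -
    have b: "bs ! i \<in> {0..<int p} \<rightarrow>\<^sub>E UNIV"
      using bs i nth_mem[of i bs] unfolding tuples_def carrier_B by blast
    have "bs ! i = (\<lambda>x \<in> {0..<int p}. \<Sum>g \<in> {0..<int p}. (bs ! i) g * delta g x)"
      using b
      by (auto simp: fun_eq_iff delta_apply PiE_def extensional_def if_distrib[of "\<lambda>u. _ * u"]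
        cong: if_cong)
    then have "F (bs[i := bs ! i]) =
        F (bs[i := \<lambda>x \<in> {0..<int p}. \<Sum>g \<in> {0..<int p}. (bs ! i) g * delta g x])"
      by simp
    also have "\<dots> = (\<Sum>g \<in> {0..<int p}. (bs ! i) g * F (bs[i := restrict (delta g) {0..<int p}]))"
      using multilinear_forms_sum[of F "integer_mod_group p" n "{0..<int p}" bs i "bs ! i" delta] F bs i
      by (simp add: B_eq carrier_group)
    finally show ?thesis by (simp add: delta_fun_def carrier_group)
  qed
  \<comment> \<open>Induction on the number \<open>k\<close> of leading slots that are still
    arbitrary; each step expands slot \<open>k - 1\<close> in delta functions.\<close>
  have "T bs = T' bs" if "k \<le> n" "bs \<in> tuples B n" "\<forall>i < n. k \<le> i \<longrightarrow> bs ! i \<in> delta ` {0..<int p}" for k bs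
    using that
  proof (induction k arbitrary: bs)
    case 0
    then have "\<forall>i < n. \<exists>g. g \<in> {0..<int p} \<and> bs ! i = delta g" by blast
    then obtain g where g: "\<And>i. i < n \<Longrightarrow> g i \<in> {0..<int p} \<and> bs ! i = delta (g i)" by metis
    have "bs = map delta (map g [0..<n])"
      using 0 g by (intro nth_equalityI) (auto simp: tuples_def)
    moreover have "map g [0..<n] \<in> words n" using g by (auto simp: words_def)
    ultimately show ?case using eq by blast
  next
    case (Suc k)
    have "T (bs[k := delta g]) = T' (bs[k := delta g])" if "g \<in> {0..<int p}" for g
    proof (rule Suc.IH)
      show "bs[k := delta g] \<in> tuples B n"
        using Suc.prems(2) delta_closed set_update_subset_insert[of bs k "delta g"]
        by (auto simp: tuples_def)
      show "\<forall>i < n. k \<le> i \<longrightarrow> bs[k := delta g] ! i \<in> delta ` {0..<int p}"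
        using Suc.prems that by (auto simp: nth_list_update tuples_def)
    qed (use Suc.prems in simp)
    then show ?case
      using slot[OF T Suc.prems(2), of k] slot[OF T' Suc.prems(2), of k] Suc.prems(1)
      by (auto intro!: sum.cong)
  qed
  from this[of n] have "T bs = T' bs" if "bs \<in> tuples B n" for bs using that by simp
  with T T' show ?thesis
    by (intro extensionalityI[of T "tuples B n"]) (auto simp: multilinear_forms_def)
qed

lemma form_eq_eval_form:
  assumes T: "T \<in> multilinear_forms B n"
  shows "T = eval_form n (words n) (\<lambda>v. v) (\<lambda>v. T (map delta v))"
proof (rule forms_eqI[OF T eval_form_closed])
  fix v assume v: "v \<in> words n"
  have "(\<Sum>w \<in> words n. T (map delta w) * eval_at w (map delta v)) =
      (\<Sum>w \<in> words n. if w = v then T (map delta w) else 0)"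
    by (rule sum.cong) (auto simp: eval_at_delta[OF _ v])
  then show "T (map delta v) = eval_form n (words n) (\<lambda>v. v) (\<lambda>v. T (map delta v)) (map delta v)"
    using map_delta_tuples[OF words_length[OF v]] v by (simp add: eval_form_def finite_words)
qed

text \<open>Letters between 0 and \<open>p - 1\<close> stay distinct in \<open>k\<close> because the
  characteristic is \<open>p\<close>.\<close>

lemma exponent_inj: "inj_on exponent (words n)"
proof (rule inj_onI)
  fix v w assume vw: "v \<in> words n" "w \<in> words n" "exponent v = exponent w"
  show "v = w"
  proof (rule nth_equalityI)
    fix i assume i: "i < length v"
    then have "(of_int (v ! i - w ! i) :: 'k) = 0"
      using fun_cong[OF vw(3), of i] vw by (simp add: exponent_def words_length)
    then have "int p dvd v ! i - w ! i"
      by (simp only: of_int_eq_0_iff_char_dvd char)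
    moreover have "v ! i \<in> {0..<int p}" "w ! i \<in> {0..<int p}"
      using vw i words_nth[of _ n i] by (simp_all add: words_length)
    ultimately show "v ! i = w ! i"
      by (metis atLeastLessThan_iff mod_eq_dvd_iff mod_pos_pos_trivial)
  qed (use vw in \<open>simp add: words_length\<close>)
qed

lemma exponent_Ints: "exponent v j \<in> \<int>"
  by (simp add: exponent_def)

lemma of_int_mod: "(of_int (a mod int p) :: 'k) = of_int a"
proof -
  have "(of_int (a - a mod int p) :: 'k) = 0"
    unfolding of_int_eq_0_iff_char_dvd char by (simp add: minus_mod_eq_mult_div)
  then show ?thesis by simp
qed

lemma exponent_surj:
  assumes "\<And>j. m j \<in> \<int>" "\<And>j. j \<ge> n \<Longrightarrow> m j = 0"
  obtains v where "v \<in> words n" "exponent v = m"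
proof -
  have "\<exists>z. m j = of_int z" for j using assms(1)[of j] by (auto elim: Ints_cases)
  then obtain z where z: "\<And>j. m j = of_int (z j)" by metis
  have "map (\<lambda>j. z j mod int p) [0..<n] \<in> words n"
    using p_pos by (auto simp: words_def)
  moreover have "exponent (map (\<lambda>j. z j mod int p) [0..<n]) = m"
    using assms(2) by (auto simp: exponent_def fun_eq_iff of_int_mod z)
  ultimately show ?thesis by (rule that)
qed

lemma symbol_supported: "symbol n T \<in> supported n"
  unfolding symbol_def
  by (intro supported_sum supported_single exponent_Ints) (auto simp: exponent_def words_length)

lemma lookup_symbol:
  assumes "v \<in> words n"
  shows "Poly_Mapping.lookup (symbol n T) (exponent v) = T (map delta v)"
proof -
  have "Poly_Mapping.lookup (symbol n T) (exponent v) =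
      (\<Sum>w \<in> words n. if w = v then T (map delta w) else 0)"
    unfolding symbol_def lookup_sum
    using assms exponent_inj by (intro sum.cong) (auto simp: lookup_single when_def dest: inj_onD)
  then show ?thesis using assms by (simp add: finite_words)
qed

text \<open>The coefficients of the symbol are the values on delta tuples, which determine a form.
  Identities between forms can thus be proved by comparing symbols.\<close>

lemma symbol_inj: "inj_on (symbol n) (multilinear_forms B n)"
  by (intro inj_onI forms_eqI) (auto simp flip: lookup_symbol)

lemma symbol_surj:
  assumes "x \<in> supported n"
  obtains T where "T \<in> multilinear_forms B n" "symbol n T = x"
proof -
  define T where "T = eval_form n (words n) (\<lambda>v. v) (\<lambda>v. Poly_Mapping.lookup x (exponent v))"
  have T: "symbol n T = (\<Sum>v \<in> words n. Poly_Mapping.single (exponent v) (Poly_Mapping.lookup x (exponent v)))"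
    unfolding T_def by (rule symbol_eval_form) (auto simp: finite_words)
  also have "\<dots> = (\<Sum>m \<in> exponent ` words n. Poly_Mapping.single m (Poly_Mapping.lookup x m))"
    by (simp add: sum.reindex[OF exponent_inj])
  also have "\<dots> = (\<Sum>m \<in> Poly_Mapping.keys x. Poly_Mapping.single m (Poly_Mapping.lookup x m))"
  proof (rule sum.mono_neutral_right)
    show "Poly_Mapping.keys x \<subseteq> exponent ` words n"
    proof
      fix m assume "m \<in> Poly_Mapping.keys x"
      with assms obtain v where "v \<in> words n" "exponent v = m"
        using exponent_surj[of m n] unfolding supported_def by blast
      then show "m \<in> exponent ` words n" by blast
    qed
  qed (auto simp: finite_words in_keys_iff)
  also have "\<dots> = x" by (rule sum_single_lookup)
  finally show ?thesis
    by (intro that[of T]) (auto simp: T_def intro!: eval_form_closed)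
qed

section \<open>Convolution as multiplication in the group algebra\<close>

definition translate :: "int \<Rightarrow> (int \<Rightarrow> 'k) \<Rightarrow> int \<Rightarrow> 'k" where
  "translate a b = (\<lambda>x \<in> {0..<int p}. b ((a + x) mod int p))"

definition word_add :: "int list \<Rightarrow> int list \<Rightarrow> int list" where
  "word_add u w = map2 (\<lambda>a b. (a + b) mod int p) u w"

lemma words_0: "words 0 = {[]}"
  by (auto simp: words_def)

lemma words_Suc: "words (Suc n) = set_Cons {0..<int p} (words n)"
  by (auto simp: words_def set_Cons_def length_Suc_conv)

text \<open>Each group element contributes one pair to \<open>comult B b\<close>; the first
  components are distinct delta functions, so the sum over words counts every term once.\<close>

lemma sum_listset_comult:
  fixes F :: "_ \<Rightarrow> 'k"
  shows "(\<Sum>zs \<in> listset (map (comult B) bs). F zs) =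
    (\<Sum>w \<in> words (length bs). F (map2 (\<lambda>a b. (delta a, translate a b)) w bs))"
proof (induction bs arbitrary: F)
  case Nil
  show ?case by (simp add: words_0)
next
  case (Cons b bs)
  have "(\<Sum>z \<in> comult B b. H z) = (\<Sum>a \<in> {0..<int p}. H (delta a, translate a b))"
    for H :: "_ \<Rightarrow> 'k"
    using sum_comult_fun_hopf_algebra[of "\<lambda>x y. H (x, y)" "integer_mod_group p" b]
    by (simp add: B_eq carrier_group translate_def)
  then show ?case by (simp add: words_Suc sum_set_Cons Cons)
qed

lemma translate_closed: "translate a b \<in> carrier B"
  by (simp add: translate_def carrier_B)

lemma map2_translate_tuples: "length w = n \<Longrightarrow> length bs = n \<Longrightarrow> map2 translate w bs \<in> tuples B n"
  using translate_closed by (auto simp: tuples_def)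

lemma word_add_closed: "u \<in> words n \<Longrightarrow> w \<in> words n \<Longrightarrow> word_add u w \<in> words n"
  using p_pos by (auto simp: words_def word_add_def)

lemma eval_at_translate:
  "u \<in> words n \<Longrightarrow> w \<in> words n \<Longrightarrow> length bs = n \<Longrightarrow>
    eval_at w (map2 translate u bs) = eval_at (word_add u w) bs"
proof (induction n arbitrary: u w bs)
  case (Suc n)
  then obtain a u' c w' b bs' where "u = a # u'" "w = c # w'" "bs = b # bs'"
    by (metis words_length length_Suc_conv)
  with Suc show ?case by (simp add: word_add_def translate_def)
qed (simp add: words_0 word_add_def)

lemma exponent_word_add:
  "u \<in> words n \<Longrightarrow> w \<in> words n \<Longrightarrow> exponent (word_add u w) = exponent u + exponent w"
  by (auto simp: exponent_def word_add_def fun_eq_iff of_int_mod words_length)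

lemma form_apply:
  assumes "T \<in> multilinear_forms B n" "bs \<in> tuples B n"
  shows "T bs = (\<Sum>v \<in> words n. T (map delta v) * eval_at v bs)"
  using fun_cong[OF form_eq_eval_form[OF assms(1)], of bs] assms(2) by (simp add: eval_form_def)

text \<open>The second leg of the comultiplication translates, so evaluations at \<open>u\<close>
  and \<open>w\<close> convolve to evaluation at \<open>word_add u w\<close>, as in a group
  algebra.\<close>

lemma convolution_eq:
  assumes f: "f \<in> multilinear_forms B n" and g: "g \<in> multilinear_forms B n"
  shows "f \<otimes>\<^bsub>convolution_monoid B n\<^esub> g =
    eval_form n (words n \<times> words n) (\<lambda>(u, w). word_add u w) (\<lambda>(u, w). f (map delta u) * g (map delta w))"
    (is "?l = ?r")
proof
  fix bs
  show "?l bs = ?r bs"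
  proof (cases "bs \<in> tuples B n")
    case True
    then have len: "length bs = n" by (simp add: tuples_def)
    have "?l bs = (\<Sum>u \<in> words n. f (map delta u) * g (map2 translate u bs))"
      using True
      by (auto simp: convolution_monoid_def sum_listset_comult len words_length comp_def case_prod_beta
        intro!: sum.cong arg_cong2[of _ _ _ _ "(*)"] arg_cong[of _ _ f] arg_cong[of _ _ g] nth_equalityI)
    also have "\<dots> = (\<Sum>u \<in> words n. f (map delta u) *
        (\<Sum>w \<in> words n. g (map delta w) * eval_at (word_add u w) bs))"
      by (intro sum.cong refl)
        (simp add: form_apply[OF g map2_translate_tuples] words_length len eval_at_translate cong: sum.cong)
    also have "\<dots> = ?r bs"
      using True by (simp add: eval_form_def sum_distrib_left mult.assoc sum.cartesian_product case_prod_beta)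
    finally show ?thesis .
  qed (simp add: convolution_monoid_def eval_form_def)
qed

lemma convolution_closed:
  "f \<in> multilinear_forms B n \<Longrightarrow> g \<in> multilinear_forms B n \<Longrightarrow>
    f \<otimes>\<^bsub>convolution_monoid B n\<^esub> g \<in> multilinear_forms B n"
  unfolding convolution_eq by (rule eval_form_closed) (auto intro: word_add_closed)

lemma symbol_convolution:
  assumes f: "f \<in> multilinear_forms B n" and g: "g \<in> multilinear_forms B n"
  shows "symbol n (f \<otimes>\<^bsub>convolution_monoid B n\<^esub> g) = symbol n f * symbol n g"
proof -
  have "symbol n (f \<otimes>\<^bsub>convolution_monoid B n\<^esub> g) =
      (\<Sum>(u, w) \<in> words n \<times> words n. Poly_Mapping.single (exponent (word_add u w)) (f (map delta u) * g (map delta w)))"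
    unfolding convolution_eq[OF assms]
    by (subst symbol_eval_form) (auto simp: finite_words word_add_closed case_prod_beta)
  also have "\<dots> = (\<Sum>(u, w) \<in> words n \<times> words n.
      Poly_Mapping.single (exponent u) (f (map delta u)) * Poly_Mapping.single (exponent w) (g (map delta w)))"
    by (rule sum.cong) (auto simp: exponent_word_add mult_single)
  also have "\<dots> = symbol n f * symbol n g"
    by (simp add: symbol_def sum_product sum.cartesian_product)
  finally show ?thesis .
qed

lemma convolution_one_eq:
  "\<one>\<^bsub>convolution_monoid B n\<^esub> = eval_form n {()} (\<lambda>_. replicate n 0) (\<lambda>_. 1)"
proof -
  have "prod_list (map (counit B) bs) = eval_at (replicate (length bs) 0) bs" for bs
    by (induction bs) (simp_all add: B_eq)
  then show ?thesis
    by (auto simp: convolution_monoid_def eval_form_def tuples_def fun_eq_iff)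
qed

lemma replicate_words: "replicate n 0 \<in> words n"
  using p_pos by (auto simp: words_def)

lemma convolution_one_closed: "\<one>\<^bsub>convolution_monoid B n\<^esub> \<in> multilinear_forms B n"
  unfolding convolution_one_eq by (rule eval_form_closed) (rule replicate_words)

lemma symbol_one: "symbol n \<one>\<^bsub>convolution_monoid B n\<^esub> = 1"
proof -
  have "exponent (replicate n 0) = 0" by (auto simp: exponent_def)
  then show ?thesis
    unfolding convolution_one_eq by (subst symbol_eval_form) (simp_all add: replicate_words)
qed

section \<open>Sweedler cofaces as cofaces of symbols\<close>

definition coface_word :: "nat \<Rightarrow> nat \<Rightarrow> int list \<Rightarrow> int list" where
  "coface_word n i v =
    (if i = 0 then 0 # v else if i = Suc n then v @ [0]
     else take (i - 1) v @ v ! (i - 1) # v ! (i - 1) # drop i v)"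

lemma coface_word_closed: "v \<in> words n \<Longrightarrow> i \<le> Suc n \<Longrightarrow> coface_word n i v \<in> words (Suc n)"
  using p_pos set_take_subset[of "i - 1" v] set_drop_subset[of i v] words_nth[of v n "i - 1"]
  by (auto simp: words_def coface_word_def)

lemma exponent_coface_word:
  assumes "v \<in> words n" "i \<le> Suc n"
  shows "exponent (coface_word n i v) = coface_exp i (exponent v)"
proof
  fix j
  have [simp]: "length v = n" using assms(1) by (rule words_length)
  show "exponent (coface_word n i v) j = coface_exp i (exponent v) j"
    using assms(2)
    by (auto simp: exponent_def coface_word_def coface_exp_def nth_append nth_Cons' min_def)
qed

text \<open>A product of functions at a point is the product of their values there, so the inner
  cofaces repeat a letter. The counit is evaluation at 0, so the outer ones insert that
  letter.\<close>

lemma coface_eq: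
  assumes f: "f \<in> multilinear_forms B n" and i: "i \<le> Suc n"
  shows "sw_coface B n i f = eval_form (Suc n) (words n) (coface_word n i) (\<lambda>v. f (map delta v))"
    (is "?l = ?r")
proof
  fix bs
  show "?l bs = ?r bs"
  proof (cases "bs \<in> tuples B (Suc n)")
    case True
    then have len: "length bs = Suc n" and bs: "set bs \<subseteq> carrier B" by (simp_all add: tuples_def)
    consider "i = 0" | "i = Suc n" | k where "i = Suc k" "k < n" using i by (cases i) force+
    \<comment> \<open>One shape for all three cases: \<open>d\<close> is the counit of the removed
      entry in the outer cases and 1 in the inner one.\<close>
    then have "\<exists>cs \<in> tuples B n. \<exists>d. ?l bs = d * f cs \<and>
        (\<forall>v \<in> words n. eval_at (coface_word n i v) bs = d * eval_at v cs)"
    proof cases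
      case 1
      obtain b cs where "bs = b # cs" using len by (cases bs) auto
      then show ?thesis using True 1
        by (intro bexI[of _ cs] exI[of _ "b 0"]) (auto simp: sw_coface_def coface_word_def tuples_def B_eq)
    next
      case 2
      obtain b cs where "bs = cs @ [b]" using len by (cases bs rule: rev_cases) auto
      then show ?thesis using True 2
        by (intro bexI[of _ cs] exI[of _ "b 0"])
          (auto simp: sw_coface_def coface_word_def tuples_def B_eq eval_at_append words_length)
    next
      case (3 k)
      define cs where "cs = take k bs @ [bs ! k \<otimes>\<^bsub>B\<^esub> bs ! Suc k] @ drop (Suc (Suc k)) bs"
      have bs_eq: "bs = take k bs @ bs ! k # bs ! Suc k # drop (Suc (Suc k)) bs"
        using len 3 by (simp add: Cons_nth_drop_Suc)
      have "cs \<in> tuples B n"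
        using len 3 bs set_take_subset[of k bs] set_drop_subset[of "Suc (Suc k)" bs]
        by (auto simp: cs_def tuples_def B_eq)
      moreover have "?l bs = 1 * f cs"
        using True 3 by (simp add: sw_coface_def cs_def)
      moreover have "eval_at (coface_word n i v) bs = 1 * eval_at v cs" if v: "v \<in> words n" for v
      proof -
        have lv: "length v = n" and vk: "v ! k \<in> {0..<int p}"
          using words_length[OF v] words_nth[OF v, of k] 3 by simp_all
        have v_eq: "v = take k v @ v ! k # drop (Suc k) v" using lv 3 by (simp add: id_take_nth_drop[symmetric])
        have "eval_at (coface_word n i v) bs =
            eval_at (take k v @ v ! k # v ! k # drop (Suc k) v)
              (take k bs @ bs ! k # bs ! Suc k # drop (Suc (Suc k)) bs)"
          using 3 bs_eq by (simp add: coface_word_def)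
        also have "\<dots> = eval_at (take k v @ v ! k # drop (Suc k) v) cs"
          using lv len 3 vk by (simp add: eval_at_append cs_def B_eq carrier_group)
        finally show ?thesis using v_eq by simp
      qed
      ultimately show ?thesis by blast
    qed
    then obtain cs d where "cs \<in> tuples B n" "?l bs = d * f cs"
      and "\<And>v. v \<in> words n \<Longrightarrow> eval_at (coface_word n i v) bs = d * eval_at v cs" by blast
    then show ?thesis
      using True by (simp add: eval_form_def form_apply[OF f] sum_distrib_left mult_ac cong: sum.cong)
  qed (simp add: sw_coface_def eval_form_def)
qed

lemma coface_closed:
  "f \<in> multilinear_forms B n \<Longrightarrow> i \<le> Suc n \<Longrightarrow> sw_coface B n i f \<in> multilinear_forms B (Suc n)"
  unfolding coface_eq by (rule eval_form_closed) (rule coface_word_closed)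

lemma symbol_coface:
  assumes "f \<in> multilinear_forms B n" "i \<le> Suc n"
  shows "symbol (Suc n) (sw_coface B n i f) = coface i (symbol n f)"
  unfolding coface_eq[OF assms] symbol_def[of n] coface_def lin_sum using assms(2)
  by (subst symbol_eval_form)
    (auto simp: finite_words coface_word_closed exponent_coface_word lin_single mult_single intro!: sum.cong)

section \<open>Cochain groups as groups of units\<close>

lemma carrier_convolution: "carrier (convolution_monoid B n) = multilinear_forms B n"
  by (simp add: convolution_monoid_def)

text \<open>The laws are pulled back from the commutative ring \<open>galg\<close> along the
  injective \<open>symbol\<close>.\<close>

lemma comm_monoid_convolution: "comm_monoid (convolution_monoid B n)"
proof (rule comm_monoidI, unfold carrier_convolution)
  show "\<one>\<^bsub>convolution_monoid B n\<^esub> \<in> multilinear_forms B n"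
    by (rule convolution_one_closed)
  fix f g h
  assume f: "f \<in> multilinear_forms B n"
  show "\<one>\<^bsub>convolution_monoid B n\<^esub> \<otimes>\<^bsub>convolution_monoid B n\<^esub> f = f"
    by (rule inj_onD[OF symbol_inj _ convolution_closed])
      (simp_all add: f convolution_one_closed symbol_convolution symbol_one)
  assume g: "g \<in> multilinear_forms B n"
  show "f \<otimes>\<^bsub>convolution_monoid B n\<^esub> g \<in> multilinear_forms B n"
    by (rule convolution_closed[OF f g])
  show "f \<otimes>\<^bsub>convolution_monoid B n\<^esub> g = g \<otimes>\<^bsub>convolution_monoid B n\<^esub> f"
    by (rule inj_onD[OF symbol_inj _ convolution_closed convolution_closed])
      (simp_all add: f g symbol_convolution mult.commute)
  assume h: "h \<in> multilinear_forms B n"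
  show "f \<otimes>\<^bsub>convolution_monoid B n\<^esub> g \<otimes>\<^bsub>convolution_monoid B n\<^esub> h =
      f \<otimes>\<^bsub>convolution_monoid B n\<^esub> (g \<otimes>\<^bsub>convolution_monoid B n\<^esub> h)"
    by (rule inj_onD[OF symbol_inj _ convolution_closed convolution_closed])
      (simp_all add: f g h symbol_convolution convolution_closed mult.assoc)
qed

lemma comm_group_cochains: "comm_group (sw_cochains B n)"
  unfolding sw_cochains_def by (rule comm_monoid.units_comm_group[OF comm_monoid_convolution])

text \<open>A convolution inverse has a supported symbol, and \<open>symbol_surj\<close> realises
  every supported inverse by a form.\<close>

lemma carrier_cochains:
  "carrier (sw_cochains B n) = {f \<in> multilinear_forms B n. symbol n f \<in> units_in n}"
proof (intro equalityI subsetI)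
  fix f assume "f \<in> carrier (sw_cochains B n)"
  then obtain g where fg: "f \<in> multilinear_forms B n" "g \<in> multilinear_forms B n"
      "f \<otimes>\<^bsub>convolution_monoid B n\<^esub> g = \<one>\<^bsub>convolution_monoid B n\<^esub>"
    by (auto simp: sw_cochains_def units_of_carrier Units_def carrier_convolution)
  then have "symbol n f * symbol n g = 1" by (simp add: symbol_one flip: symbol_convolution)
  then show "f \<in> {f \<in> multilinear_forms B n. symbol n f \<in> units_in n}"
    using fg(1) by (auto intro: units_inI symbol_supported)
next
  fix f assume "f \<in> {f \<in> multilinear_forms B n. symbol n f \<in> units_in n}"
  then obtain y where f: "f \<in> multilinear_forms B n" and y: "y \<in> supported n" "symbol n f * y = 1"
    by (auto simp: units_in_def)
  obtain g where g: "g \<in> multilinear_forms B n" "symbol n g = y" by (rule symbol_surj[OF y(1)])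
  interpret comm_monoid "convolution_monoid B n" by (rule comm_monoid_convolution)
  have "f \<otimes>\<^bsub>convolution_monoid B n\<^esub> g = \<one>\<^bsub>convolution_monoid B n\<^esub>"
    by (rule inj_onD[OF symbol_inj _ convolution_closed])
      (use f g y in \<open>simp_all add: symbol_convolution symbol_one convolution_one_closed\<close>)
  moreover have "g \<otimes>\<^bsub>convolution_monoid B n\<^esub> f = f \<otimes>\<^bsub>convolution_monoid B n\<^esub> g"
    by (rule m_comm) (simp_all add: carrier_convolution f g)
  ultimately show "f \<in> carrier (sw_cochains B n)"
    using f g by (auto simp: sw_cochains_def units_of_carrier Units_def carrier_convolution)
qed

lemma one_cochains: "\<one>\<^bsub>sw_cochains B n\<^esub> = \<one>\<^bsub>convolution_monoid B n\<^esub>"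
  by (simp add: sw_cochains_def units_of_one)

lemma symbol_mult:
  "f \<in> carrier (sw_cochains B n) \<Longrightarrow> g \<in> carrier (sw_cochains B n) \<Longrightarrow>
    symbol n (f \<otimes>\<^bsub>sw_cochains B n\<^esub> g) = symbol n f * symbol n g"
  unfolding carrier_cochains by (simp add: sw_cochains_def units_of_mult symbol_convolution)

lemma symbol_units_in: "f \<in> carrier (sw_cochains B n) \<Longrightarrow> symbol n f \<in> units_in n"
  by (simp add: carrier_cochains)

lemma symbol_eqI:
  "f \<in> carrier (sw_cochains B n) \<Longrightarrow> g \<in> carrier (sw_cochains B n) \<Longrightarrow>
    symbol n f = symbol n g \<Longrightarrow> f = g"
  unfolding carrier_cochains using symbol_inj by (auto dest: inj_onD)

lemma cochain_of_unit:
  assumes "x \<in> units_in n"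
  obtains f where "f \<in> carrier (sw_cochains B n)" "symbol n f = x"
proof -
  have "x \<in> supported n" using assms by (simp add: units_in_def)
  then obtain f where "f \<in> multilinear_forms B n" "symbol n f = x" by (rule symbol_surj)
  with assms show ?thesis by (intro that[of f]) (simp_all add: carrier_cochains)
qed

lemma symbol_inv:
  assumes "f \<in> carrier (sw_cochains B n)"
  shows "symbol n (inv\<^bsub>sw_cochains B n\<^esub> f) = inverse_of (symbol n f)"
proof -
  interpret comm_group "sw_cochains B n" by (rule comm_group_cochains)
  have "symbol n f * symbol n (inv\<^bsub>sw_cochains B n\<^esub> f) = 1"
    using assms by (simp add: one_cochains symbol_one flip: symbol_mult)
  then show ?thesis by (rule inverse_of_unique[symmetric])
qed

lemma symbol_finprod:
  assumes "finite I" "\<And>i. i \<in> I \<Longrightarrow> f i \<in> carrier (sw_cochains B n)"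
  shows "symbol n (\<Otimes>\<^bsub>sw_cochains B n\<^esub> i \<in> I. f i) = (\<Prod>i \<in> I. symbol n (f i))"
proof -
  interpret comm_group "sw_cochains B n" by (rule comm_group_cochains)
  show ?thesis using assms
    by (induction I rule: finite_induct)
      (simp_all add: one_cochains symbol_one symbol_mult Pi_def finprod_closed)
qed

lemma coface_cochains:
  assumes "f \<in> carrier (sw_cochains B n)" "i \<le> Suc n"
  shows "sw_coface B n i f \<in> carrier (sw_cochains B (Suc n))"
  using assms by (simp add: carrier_cochains coface_closed symbol_coface coface_units_in)

lemma
  assumes f: "f \<in> carrier (sw_cochains B n)"
  shows sw_differential_closed: "sw_differential B n f \<in> carrier (sw_cochains B (Suc n))"
    and symbol_differential: "symbol (Suc n) (sw_differential B n f) = differential n (symbol n f)"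
proof -
  interpret comm_group "sw_cochains B (Suc n)" by (rule comm_group_cochains)
  let ?g = "\<lambda>i. if even i then sw_coface B n i f
    else inv\<^bsub>sw_cochains B (Suc n)\<^esub> (sw_coface B n i f)"
  have g: "?g i \<in> carrier (sw_cochains B (Suc n))" if "i \<le> Suc n" for i
    using coface_cochains[OF f that] by simp
  then show "sw_differential B n f \<in> carrier (sw_cochains B (Suc n))"
    unfolding sw_differential_def by (intro finprod_closed) auto
  have "symbol (Suc n) (sw_differential B n f) = (\<Prod>i \<le> Suc n. symbol (Suc n) (?g i))"
    unfolding sw_differential_def by (rule symbol_finprod) (use g in auto)
  also have "\<dots> = differential n (symbol n f)"
    unfolding differential_def sgn_pow_def
  proof (rule prod.cong[OF refl])
    fix i assume "i \<in> {..Suc n}"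
    then have "i \<le> Suc n" by simp
    moreover have "f \<in> multilinear_forms B n" using f by (simp add: carrier_cochains)
    ultimately show "symbol (Suc n) (?g i) =
        (if even i then coface i (symbol n f) else inverse_of (coface i (symbol n f)))"
      by (simp add: symbol_inv[OF coface_cochains[OF f]] symbol_coface)
  qed
  finally show "symbol (Suc n) (sw_differential B n f) = differential n (symbol n f)" .
qed

lemma cocycles_iff:
  "f \<in> sw_cocycles B n \<longleftrightarrow>
    f \<in> carrier (sw_cochains B n) \<and> differential n (symbol n f) = 1"
proof -
  interpret comm_group "sw_cochains B (Suc n)" by (rule comm_group_cochains)
  have "sw_differential B n f = \<one>\<^bsub>sw_cochains B (Suc n)\<^esub> \<longleftrightarrow> differential n (symbol n f) = 1"
    if "f \<in> carrier (sw_cochains B n)"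
    using symbol_eqI[OF sw_differential_closed[OF that] one_closed]
    by (auto simp: symbol_differential[OF that] one_cochains symbol_one
      dest: arg_cong[of _ _ "symbol (Suc n)"])
  then show ?thesis by (auto simp: sw_cocycles_def kernel_def)
qed

lemma subgroup_cocycles: "subgroup (sw_cocycles B n) (sw_cochains B n)"
proof -
  interpret G: comm_group "sw_cochains B n" by (rule comm_group_cochains)
  interpret H: comm_group "sw_cochains B (Suc n)" by (rule comm_group_cochains)
  have "group_hom (sw_cochains B n) (sw_cochains B (Suc n)) (sw_differential B n)"
  proof (unfold_locales, rule homI)
    fix f g assume fg: "f \<in> carrier (sw_cochains B n)" "g \<in> carrier (sw_cochains B n)"
    show "sw_differential B n (f \<otimes>\<^bsub>sw_cochains B n\<^esub> g) =
        sw_differential B n f \<otimes>\<^bsub>sw_cochains B (Suc n)\<^esub> sw_differential B n g"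
      using fg
      by (intro symbol_eqI[of _ "Suc n"])
        (simp_all add: sw_differential_closed symbol_differential symbol_mult differential_mult symbol_units_in)
  qed (rule sw_differential_closed)
  then show ?thesis unfolding sw_cocycles_def by (rule group_hom.subgroup_kernel)
qed

lemma comm_group_cocycles: "comm_group ((sw_cochains B n)\<lparr>carrier := sw_cocycles B n\<rparr>)"
proof -
  interpret comm_group "sw_cochains B n" by (rule comm_group_cochains)
  have "group ((sw_cochains B n)\<lparr>carrier := sw_cocycles B n\<rparr>)"
    by (rule subgroup_imp_group[OF subgroup_cocycles])
  then show ?thesis
    by (rule group.group_comm_groupI) (simp add: cocycles_iff m_comm)
qed

end

section \<open>From cochains to cohomology groups\<close>

lemma (in comm_group) trivial_group_Mod_carrier: "trivial_group (G Mod carrier G)"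
proof -
  have "carrier G \<lhd> G" by (rule subgroup_imp_normal[OF subgroup_self])
  moreover have "rcosets (carrier G) = {carrier G}"
    by (auto simp: RCOSETS_def coset_join2 subgroup_self)
  ultimately show ?thesis
    by (simp add: trivial_group_def normal.factorgroup_is_group) (simp add: FactGroup_def)
qed

theorem corollary5p6:
  fixes p :: nat and B :: "('k::alg_closed_field, int \<Rightarrow> 'k) hopf_algebra"
  assumes "CHAR('k) = p" and "p > 0"
    and "B = fun_hopf_algebra (integer_mod_group p)"
  shows "sw_cohomology B 1 \<cong> integer_mod_group p \<and>
    (\<forall>i \<ge> 2. trivial_group (sw_cohomology B i))"
proof (intro conjI allI impI)
  interpret cyclic_functions p B by unfold_locales (rule assms)+
  have char_pos: "CHAR('k) > 0" using assms by simp
  {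
    fix i :: nat assume "i \<ge> 2"
    then obtain k where i: "i = Suc k" "k > 0" by (cases i) auto
    \<comment> \<open>By acyclicity the cohomology is the group of cocycles modulo itself.\<close>
    have "sw_coboundaries B i = sw_cocycles B i"
    proof (intro equalityI subsetI)
      fix f assume "f \<in> sw_coboundaries B i"
      then obtain g where "g \<in> carrier (sw_cochains B k)" "f = sw_differential B k g"
        by (auto simp: sw_coboundaries_def i)
      then show "f \<in> sw_cocycles B i"
        unfolding i(1) cocycles_iff
        by (simp add: sw_differential_closed symbol_differential differential_differential symbol_units_in)
    next
      fix f assume "f \<in> sw_cocycles B i"
      then have f: "f \<in> carrier (sw_cochains B (Suc k))" "differential (Suc k) (symbol (Suc k) f) = 1"
        by (simp_all add: i cocycles_iff)
      obtain u where u: "u \<in> units_in k" "differential k u = symbol (Suc k) f"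
        by (rule differential_exact[OF char_pos i(2) symbol_units_in[OF f(1)] f(2)])
      obtain g where g: "g \<in> carrier (sw_cochains B k)" "symbol k g = u"
        by (rule cochain_of_unit[OF u(1)])
      have "f = sw_differential B k g"
        using f(1) g u by (intro symbol_eqI[of _ "Suc k"]) (simp_all add: sw_differential_closed symbol_differential)
      then show "f \<in> sw_coboundaries B i"
        using g(1) by (auto simp: sw_coboundaries_def i)
    qed
    then show "trivial_group (sw_cohomology B i)"
      using comm_group.trivial_group_Mod_carrier[OF comm_group_cocycles, of i]
      by (simp add: sw_cohomology_def)
  }
  let ?Z = "(sw_cochains B 1)\<lparr>carrier := sw_cocycles B 1\<rparr>"
  interpret C1: comm_group "sw_cochains B 1" by (rule comm_group_cochains)
  interpret Z: comm_group ?Z by (rule comm_group_cocycles)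
  \<comment> \<open>Degree 0 cochains are scalars with trivial differential, so the first cohomology
    is the group of cocycles itself.\<close>
  have "sw_coboundaries B 1 = {\<one>\<^bsub>sw_cochains B 1\<^esub>}"
  proof -
    interpret C0: comm_group "sw_cochains B 0" by (rule comm_group_cochains)
    have "sw_differential B 0 f = \<one>\<^bsub>sw_cochains B 1\<^esub>" if "f \<in> carrier (sw_cochains B 0)" for f
      using sw_differential_closed[OF that] symbol_differential[OF that] C1.one_closed
      by (intro symbol_eqI[of _ 1])
        (simp_all add: differential_0 symbol_units_in[OF that] one_cochains symbol_one)
    then show ?thesis using C0.one_closed by (auto simp: sw_coboundaries_def)
  qed
  then have "sw_cohomology B 1 \<cong> ?Z"
    using Z.trivial_factor_iso by (auto simp: sw_cohomology_def intro: is_isoI)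
  moreover have "integer_mod_group p \<cong> ?Z"
  proof -
    \<comment> \<open>Evaluation at the point \<open>a\<close>, whose symbol is the power
      \<open>a\<close> of the single variable; by \<open>cocycles_1\<close> these powers are all the
      cocycles.\<close>
    define \<phi> where "\<phi> a = eval_form 1 {()} (\<lambda>_. [a]) (\<lambda>_. 1)" for a
    have word: "[a] \<in> words 1 \<longleftrightarrow> a \<in> {0..<int p}" for a
      by (simp add: words_def)
    have expo: "exponent [a] = axis (of_int a)" for a
      by (auto simp: exponent_def axis_def)
    have symbol: "symbol 1 (\<phi> a) = grouplike (axis (of_int a))" if "a \<in> {0..<int p}" for a
      unfolding \<phi>_def expo[symmetric] by (subst symbol_eval_form) (use that word in auto)
    have closed: "\<phi> a \<in> sw_cocycles B 1" if a: "a \<in> {0..<int p}" for a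
    proof -
      have "symbol 1 (\<phi> a) \<in> units_in 1 \<and> differential 1 (symbol 1 (\<phi> a)) = 1"
        using cocycles_1[OF char_pos, of "symbol 1 (\<phi> a)"] symbol[OF a] Ints_of_int by blast
      moreover have "\<phi> a \<in> multilinear_forms B 1"
        unfolding \<phi>_def by (rule eval_form_closed) (use a word in blast)
      ultimately show ?thesis by (simp add: cocycles_iff carrier_cochains)
    qed
    then have closed': "\<phi> a \<in> carrier (sw_cochains B 1)" if "a \<in> {0..<int p}" for a
      using that by (simp add: cocycles_iff)
    have "\<phi> \<in> iso (integer_mod_group p) ?Z"
    proof (rule isoI)
      show "\<phi> \<in> hom (integer_mod_group p) ?Z"
      proof (rule homI)
        fix a b assume ab: "a \<in> carrier (integer_mod_group p)" "b \<in> carrier (integer_mod_group p)"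
        have "axis (of_int a) + axis (of_int b) = axis (of_int ((a + b) mod int p) :: 'k)"
          by (auto simp: axis_def of_int_mod fun_eq_iff)
        moreover have "(a + b) mod int p \<in> {0..<int p}" using p_pos by simp
        ultimately have "symbol 1 (\<phi> ((a + b) mod int p)) = symbol 1 (\<phi> a \<otimes>\<^bsub>sw_cochains B 1\<^esub> \<phi> b)"
          using ab unfolding carrier_group
          by (simp only: symbol symbol_mult[OF closed' closed'] mult_single mult_1)
        then have "\<phi> ((a + b) mod int p) = \<phi> a \<otimes>\<^bsub>sw_cochains B 1\<^esub> \<phi> b"
          using ab p_pos unfolding carrier_group by (intro symbol_eqI[OF closed' C1.m_closed] closed') simp_all
        then show "\<phi> (a \<otimes>\<^bsub>integer_mod_group p\<^esub> b) = \<phi> a \<otimes>\<^bsub>?Z\<^esub> \<phi> b" by simp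
      qed (use closed in \<open>simp add: carrier_group\<close>)
      show "bij_betw \<phi> (carrier (integer_mod_group p)) (carrier ?Z)"
        unfolding bij_betw_def carrier_group
      proof (intro conjI equalityI subsetI inj_onI)
        fix a b assume ab: "a \<in> {0..<int p}" "b \<in> {0..<int p}" "\<phi> a = \<phi> b"
        \<comment> \<open>Equal monomials have equal exponents, and \<open>exponent_inj\<close>
          recovers the residue from its image in \<open>k\<close>.\<close>
        have "Poly_Mapping.keys (grouplike (axis (of_int a) :: nat \<Rightarrow> 'k)) =
            Poly_Mapping.keys (grouplike (axis (of_int b) :: nat \<Rightarrow> 'k))"
          unfolding symbol[OF ab(1), symmetric] symbol[OF ab(2), symmetric] ab(3) ..
        then have "exponent [a] = exponent [b]" by (simp add: expo)
        then show "a = b" using inj_onD[OF exponent_inj] ab word by blast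
      next
        fix f assume "f \<in> carrier ?Z"
        then have f: "f \<in> carrier (sw_cochains B 1)" "differential 1 (symbol 1 f) = 1"
          by (simp_all add: cocycles_iff)
        then obtain c where c: "c \<in> \<int>" "symbol 1 f = grouplike (axis c)"
          using cocycles_1[OF char_pos, of "symbol 1 f"] symbol_units_in[OF f(1)] by blast
        obtain v where v: "v \<in> words 1" "exponent v = axis c"
          by (rule exponent_surj[of "axis c" 1]) (use c in \<open>auto simp: axis_def\<close>)
        then obtain a where a: "v = [a]" "a \<in> {0..<int p}"
          using word by (metis One_nat_def length_Suc_conv length_0_conv words_length)
        have "symbol 1 f = symbol 1 (\<phi> a)"
          unfolding symbol[OF a(2)] c(2) v(2)[symmetric] a(1) expo ..
        then have "f = \<phi> a" by (rule symbol_eqI[OF f(1) closed'[OF a(2)]])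
        then show "f \<in> \<phi> ` {0..<int p}" using a by blast
      qed (use closed in auto)
    qed
    then show ?thesis by (rule is_isoI)
  qed
  ultimately show "sw_cohomology B 1 \<cong> integer_mod_group p"
    using group.iso_sym[OF group_integer_mod_group] iso_trans by blast
qed

end
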